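(* Let $n\ge 2$ and let the edges $e$ of the standard graph $\Sigma_n$ have positive conductances $a_e$. For an edge $e$ of $\Sigma_n$, let $v_1$ and $v_2$ be the endpoints of $e$, and let $f_1$ and $f_2$ be the faces bounded by $e$ (the two unit squares adjacent to $e$, bounded or external). Then $$a_e=\frac{Z_{v_1}Z_{v_2}}{Z_{f_1}Z_{f_2}}.$$
   Context: Standard graph $\Sigma_n$: the vertices are the pairs $(i,j)$ (row $i$ counted from the top, column $j$ counted from the left) with $1\le i\le n$ and $1\le j\le\min(i,n+1-i)$; edges join horizontally adjacent vertices $(i,j),(i,j+1)$ and vertically adjacent vertices $(i,j),(i+1,j)$. The nodes are the rightmost vertices of the rows: node $i$ is the vertex $(i,\min(i,n+1-i))$, $i=1,\dots,n$. Thus $\Sigma_n$ has $n$ nodes on its outer face and $n(n-1)/2$ edges; column $j$ has top vertex node $j$ and bottom vertex node $n+1-j$. Groves: a grove is a spanning forest of $\Sigma_n$ in which every component tree contains at least one node; it induces a partition of the nodes (two nodes are in the same part iff they are in the same tree). $Z_\pi$ is the sum, over groves inducing the partition $\pi$, of the product of the conductances $a_e$ of the edges of the grove. Nested pairing of a (possibly empty) interval of nodes $p,p+1,\dots,q$: the parts $\{p,q\},\{p+1,q-1\},\dots$, with the middle node a singleton if the interval has odd size. Vertices: for a vertex $v=(i,j)$, let $v_\to$ be node $i$ (horizontally across from $v$), $v_\uparrow$ node $j$ and $v_\downarrow$ node $n+1-j$ (in the same column as $v$). The partition $\pi_v$ consists of the part $\{v_\to,v_\uparrow,v_\downarrow\}$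 (a set, with coinciding nodes identified), the pairs $\{k,n+1-k\}$ for $1\le k\le j-1$, the nested pairing of the nodes strictly between $j$ and $i$, and the nested pairing of the nodes strictly between $i$ and $n+1-j$. Write $Z_v=Z_{\pi_v}$. Faces: for $0\le j$ and $j\le i\le n-j$ with $1\le i\le n-1$, let $f_{i,j}$ be the unit square lying between rows $i,i+1$ and columns $j,j+1$ (it is a bounded face of $\Sigma_n$ if its four corners are vertices, otherwise it is an "external face", regarded as part of the unbounded face; $j=0$ gives the external faces on the left of $\Sigma_n$). The partition $\pi_{f}$ for $f=f_{i,j}$ consists of the pairs $\{k,n+1-k\}$ for $1\le k\le j$, the nested pairing of the nodes $j+1,\dots,i$, and the nested pairing of the nodes $i+1,\dots,n-j$. (For external faces not on the left this is always $1,n|2,n-1|\cdots$.) Write $Z_f=Z_{\pi_f}$. The two faces adjacent to a horizontal edge $(i,j)(i,j+1)$ are $f_{i-1,j}$ and $f_{i,j}$; the two faces adjacent to a vertical edge $(i,j)(i+1,j)$ are $f_{i,j-1}$ and $f_{i,j}$. *)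

theory Defs
  imports Complex_Main
begin

type_synonym vertex = "nat \<times> nat"

definition vertices :: "nat \<Rightarrow> vertex set" where
  "vertices n = {(i, j). 1 \<le> i \<and> i \<le> n \<and> 1 \<le> j \<and> j \<le> min i (n + 1 - i)}"

definition edges :: "nat \<Rightarrow> vertex set set" where
  "edges n =
     {{(i, j), (i, j + 1)} | i j. (i, j) \<in> vertices n \<and> (i, j + 1) \<in> vertices n} \<union>
     {{(i, j), (i + 1, j)} | i j. (i, j) \<in> vertices n \<and> (i + 1, j) \<in> vertices n}"

definition node :: "nat \<Rightarrow> nat \<Rightarrow> vertex" where
  "node n i = (i, min i (n + 1 - i))"

text \<open>A spanning subgraph is given by its edge set; its vertex set is always \<open>vertices n\<close>.\<close>

definition connected_in :: "vertex set set \<Rightarrow> (vertex \<times> vertex) set" where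
  "connected_in S = {(u, v). {u, v} \<in> S}\<^sup>*"

definition is_cycle :: "vertex set set \<Rightarrow> vertex list \<Rightarrow> bool" where
  "is_cycle S p \<longleftrightarrow> 3 \<le> length p \<and> distinct p \<and>
     (\<forall>k < length p. {p ! k, p ! ((k + 1) mod length p)} \<in> S)"

definition grove :: "nat \<Rightarrow> vertex set set \<Rightarrow> bool" where
  "grove n S \<longleftrightarrow> S \<subseteq> edges n \<and> (\<nexists>p. is_cycle S p) \<and>
     (\<forall>v \<in> vertices n. \<exists>k \<in> {1..n}. (v, node n k) \<in> connected_in S)"

definition node_partition :: "nat \<Rightarrow> vertex set set \<Rightarrow> nat set set" where
  "node_partition n S = {1..n} // {(k, l) \<in> {1..n} \<times> {1..n}. (node n k, node n l) \<in> connected_in S}"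

definition Z :: "nat \<Rightarrow> (vertex set \<Rightarrow> real) \<Rightarrow> nat set set \<Rightarrow> real" where
  "Z n a \<pi> = (\<Sum>S | grove n S \<and> node_partition n S = \<pi>. \<Prod>e\<in>S. a e)"

text \<open>The nested pairing of the interval \<open>p, \<dots>, q\<close>, empty if \<open>q < p\<close>. The guard
  \<open>p + 2 * t \<le> q\<close> says \<open>p + t \<le> q - t\<close> without truncated subtraction; equality gives
  the singleton in the middle.\<close>

definition nested_pairing :: "nat \<Rightarrow> nat \<Rightarrow> nat set set" where
  "nested_pairing p q = {{p + t, q - t} | t. p + 2 * t \<le> q}"

fun vertex_partition :: "nat \<Rightarrow> vertex \<Rightarrow> nat set set" where
  "vertex_partition n (i, j) =
     {{i, j, n + 1 - j}} \<union> {{k, n + 1 - k} | k. 1 \<le> k \<and> k \<le> j - 1} \<union>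
     nested_pairing (j + 1) (i - 1) \<union> nested_pairing (i + 1) (n - j)"

text \<open>The pair \<open>(i, j)\<close> stands for the unit square between rows \<open>i\<close>, \<open>i + 1\<close> and columns
  \<open>j\<close>, \<open>j + 1\<close>. External squares are included, so corners need not be vertices of the
  graph and \<open>j = 0\<close> is allowed.\<close>

definition faces :: "nat \<Rightarrow> (nat \<times> nat) set" where
  "faces n = {(i, j). 1 \<le> i \<and> i \<le> n - 1 \<and> j \<le> i \<and> i + j \<le> n}"

fun corners :: "nat \<times> nat \<Rightarrow> (nat \<times> nat) set" where
  "corners (i, j) = {(i, j), (i, j + 1), (i + 1, j), (i + 1, j + 1)}"

definition adjacent_faces :: "nat \<Rightarrow> vertex set \<Rightarrow> (nat \<times> nat) set" where
  "adjacent_faces n e = {f \<in> faces n. e \<subseteq> corners f}"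

fun face_partition :: "nat \<Rightarrow> nat \<times> nat \<Rightarrow> nat set set" where
  "face_partition n (i, j) =
     {{k, n + 1 - k} | k. 1 \<le> k \<and> k \<le> j} \<union>
     nested_pairing (j + 1) i \<union> nested_pairing (i + 1) (n - j)"

lemma adjacent_faces_horizontal:
  assumes "(i, j) \<in> vertices n" "(i, j + 1) \<in> vertices n"
  shows "adjacent_faces n {(i, j), (i, j + 1)} = {(i - 1, j), (i, j)}"
  using assms by (auto simp: adjacent_faces_def faces_def vertices_def)

lemma adjacent_faces_vertical:
  assumes "(i, j) \<in> vertices n" "(i + 1, j) \<in> vertices n"
  shows "adjacent_faces n {(i, j), (i + 1, j)} = {(i, j - 1), (i, j)}"
  using assms by (auto simp: adjacent_faces_def faces_def vertices_def)

lemma finite_edges: "finite (edges n)"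
proof (rule finite_subset)
  show "edges n \<subseteq> Pow ({0..n} \<times> {0..n})"
    by (auto simp: edges_def vertices_def)
qed simp

end

theory Submission
  imports Defs
begin

text \<open>
  Each partition attached to a vertex or a face is induced by exactly one grove, so each \<open>Z\<close> in the
  formula is a single product of conductances, and the formula says which edges occur in which of
  four explicit groves.

  The grove of a vertex or face is read off from its center \<open>P\<close> (the vertex itself, or the midpoint
  of the square). It contains a vertical edge iff the row offset of its midpoint from \<open>P\<close> exceeds,
  in absolute value, the column offset (which is signed), and a horizontal edge iff it is smaller.
  Parity excludes ties. The columns to the left of \<open>P\<close> are therefore full vertical paths, and above
  and below \<open>P\<close> there are nested L-shaped paths with their corners on the diagonal and the
  antidiagonal through \<open>P\<close>. If \<open>P\<close> is a vertex, the three pieces ending at \<open>P\<close> form a tripod.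

  In the coordinates \<open>A\<close> (row plus column) and \<open>B\<close> (row minus column) of \<open>P\<close>, a given edge \<open>d\<close>
  belongs to the grove iff a bound on \<open>A\<close> and a bound on \<open>B\<close> hold (\<open>d\<close> horizontal), or iff one of
  them does (\<open>d\<close> vertical). The endpoints of an edge \<open>e\<close> and the two faces next to \<open>e\<close> are the two
  pairs of opposite corners of a unit square in the \<open>(A, B)\<close> plane. Hence \<open>d\<close> occurs equally often
  in the two vertex groves and in the two face groves, unless both of its bounds switch across this
  square. That happens for \<open>d = e\<close> only, which occurs once more in the vertex groves
  (\<open>vertical_balance\<close>, \<open>horizontal_balance\<close>).

  The main work is uniqueness (\<open>S_eq_forest\<close>). Let \<open>S\<close> be any grove that induces the same partition.
  A tree of the explicit grove crosses each grid line at most once, and when it does, the line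
  separates two nodes of the part, so the corresponding tree of \<open>S\<close> crosses it as well. Hence each
  tree of \<open>S\<close> has at least as many edges as the corresponding explicit tree, and so, being acyclic,
  at least as many vertices. As both groves span the same vertices, equality holds
  everywhere, and no tree of \<open>S\<close> crosses any other grid line. This
  confines the trees of \<open>S\<close>: the leftmost column of the part whose tree
  contains a vertex \<open>v\<close> is at most the one prescribed by the explicit grove
  (\<open>class_label_bound\<close>). Summed over all \<open>v\<close> the two sides agree, since corresponding trees have
  equally many vertices. So both groves split the vertices in the same way, and then their edges
  agree too.
\<close>

section \<open>Edge counts in acyclic graphs\<close>

text \<open>
  The first vertex of a longest simple path has all its neighbors on the path, so a second edge at
  it closes a cycle.
\<close>

lemma acyclic_leaf:
  assumes fin: "finite W" and ne: "W \<noteq> {}"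
    and E: "\<And>e. e \<in> E \<Longrightarrow> \<exists>u\<in>W. \<exists>v\<in>W. u \<noteq> v \<and> e = {u, v}"
    and acyc: "\<nexists>p. is_cycle E p"
  shows "\<exists>w\<in>W. \<forall>e\<in>E. \<forall>e'\<in>E. w \<in> e \<longrightarrow> w \<in> e' \<longrightarrow> e = e'"
proof (rule ccontr)
  assume no_leaf: "\<not> ?thesis"
  define walk where "walk p \<longleftrightarrow> p \<noteq> [] \<and> distinct p \<and> set p \<subseteq> W \<and>
    (\<forall>k. Suc k < length p \<longrightarrow> {p ! k, p ! Suc k} \<in> E)" for p
  obtain w0 where "w0 \<in> W" using ne by blast
  then have ex: "walk [w0]" by (simp add: walk_def)
  have bound: "walk p \<Longrightarrow> length p < Suc (card W)" for p
    unfolding walk_def by (metis card_mono distinct_card fin less_Suc_eq_le)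
  obtain p where p: "walk p" and longest: "\<And>q. walk q \<Longrightarrow> length q \<le> length p"
    using ex_has_greatest_nat[of walk "[w0]" length "Suc (card W)"] ex bound
    by metis
  define w where "w = p ! 0"
  have len: "0 < length p" using p by (simp add: walk_def)
  then have "w \<in> W" using p by (auto simp: walk_def w_def)
  then obtain e e' where e: "e \<in> E" "e' \<in> E" "w \<in> e" "w \<in> e'" "e \<noteq> e'"
    using no_leaf by blast
  have other: "\<exists>a\<in>W. a \<noteq> w \<and> d = {w, a}" if "d \<in> E" "w \<in> d" for d
    using E[OF that(1)] that(2) by auto
  obtain a where a: "a \<in> W" "a \<noteq> w" "e = {w, a}" using other e by blast
  obtain b where b: "b \<in> W" "b \<noteq> w" "e' = {w, b}" using other e by blast
  have index: "\<exists>i. 0 < i \<and> i < length p \<and> x = p ! i" if x: "x \<in> W" "x \<noteq> w" "{w, x} \<in> E" for x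
  proof -
    have "x \<in> set p"
    proof (rule ccontr)
      assume "x \<notin> set p"
      then have "walk (x # p)"
        using p x len by (auto simp: walk_def nth_Cons w_def insert_commute split: nat.splits)
      then show False using longest by fastforce
    qed
    then show ?thesis using x by (metis in_set_conv_nth gr0I w_def)
  qed
  have closing: False if i: "2 \<le> i" "i < length p" "{w, p ! i} \<in> E" for i
  proof -
    have "is_cycle E (take (Suc i) p)"
      unfolding is_cycle_def
    proof (intro conjI allI impI)
      show "3 \<le> length (take (Suc i) p)" using i by simp
      show "distinct (take (Suc i) p)" using p by (simp add: walk_def)
      fix k assume "k < length (take (Suc i) p)"
      then have k: "k \<le> i" using i by simp
      show "{take (Suc i) p ! k, take (Suc i) p ! ((k + 1) mod length (take (Suc i) p))} \<in> E"
      proof (cases "k = i")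
        case True
        then show ?thesis using i by (simp add: w_def insert_commute)
      next
        case False
        then show ?thesis using i k p by (simp add: walk_def)
      qed
    qed
    then show False using acyc by blast
  qed
  obtain i where i: "0 < i" "i < length p" "a = p ! i" using index a e by blast
  obtain j where j: "0 < j" "j < length p" "b = p ! j" using index b e by blast
  have "i \<noteq> j" using a b e i j by auto
  then have "2 \<le> i \<or> 2 \<le> j" using i j by linarith
  then show False using closing a b e i j by metis
qed

lemma acyclic_card_edges:
  assumes "finite W" "W \<noteq> {}"
    and "\<And>e. e \<in> E \<Longrightarrow> \<exists>u\<in>W. \<exists>v\<in>W. u \<noteq> v \<and> e = {u, v}"
    and "\<nexists>p. is_cycle E p"
  shows "card E < card W"
  using assms
proof (induction "card W" arbitrary: W E rule: less_induct)
  case less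
  obtain w where w: "w \<in> W" "\<And>e e'. e \<in> E \<Longrightarrow> e' \<in> E \<Longrightarrow> w \<in> e \<Longrightarrow> w \<in> e' \<Longrightarrow> e = e'"
    using acyclic_leaf[OF less.prems] by blast
  have finE: "finite E"
    by (rule finite_subset[of _ "Pow W"]) (use less.prems in auto)
  show ?case
  proof (cases "W = {w}")
    case True
    then have "E = {}" using less.prems(3) by fastforce
    then show ?thesis using True by simp
  next
    case False
    let ?E = "{e \<in> E. w \<notin> e}"
    have "card ?E < card (W - {w})"
    proof (rule less.hyps)
      show "card (W - {w}) < card W" using w less.prems by (meson card_Diff1_less)
      show "W - {w} \<noteq> {}" using False w by blast
      show "\<exists>u\<in>W - {w}. \<exists>v\<in>W - {w}. u \<noteq> v \<and> e = {u, v}" if e: "e \<in> ?E" for e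
      proof -
        obtain u v where "u \<in> W" "v \<in> W" "u \<noteq> v" "e = {u, v}" using less.prems(3) e by blast
        then show ?thesis using e by blast
      qed
      show "\<nexists>p. is_cycle ?E p"
        using less.prems(4) unfolding is_cycle_def by blast
    qed (use less.prems in simp)
    moreover have "card E \<le> card ?E + 1"
    proof -
      have "card {e \<in> E. w \<in> e} \<le> 1"
        using w(2) finE by (simp add: card_le_Suc0_iff_eq)
      moreover have "card E = card (?E \<union> {e \<in> E. w \<in> e})" by (rule arg_cong[where f = card]) blast
      ultimately show ?thesis
        using card_Un_le[of ?E "{e \<in> E. w \<in> e}"] by linarith
    qed
    moreover have "card W = card (W - {w}) + 1"
      using card_Suc_Diff1[OF less.prems(1) w(1)] by linarith
    ultimately show ?thesis by linarith
  qed
qed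

section \<open>Connectivity and quotients\<close>

lemma connected_in_refl [simp]: "(x, x) \<in> connected_in S"
  by (simp add: connected_in_def)

lemma connected_in_sym: "(x, y) \<in> connected_in S \<Longrightarrow> (y, x) \<in> connected_in S"
proof -
  have "sym {(u, v). {u, v} \<in> S}" by (auto simp: sym_def insert_commute)
  then show "(x, y) \<in> connected_in S \<Longrightarrow> (y, x) \<in> connected_in S"
    unfolding connected_in_def by (meson sym_rtrancl symD)
qed

lemma connected_in_trans:
  "(x, y) \<in> connected_in S \<Longrightarrow> (y, z) \<in> connected_in S \<Longrightarrow> (x, z) \<in> connected_in S"
  unfolding connected_in_def by simp

lemma connected_in_edge: "{x, y} \<in> S \<Longrightarrow> (x, y) \<in> connected_in S"
  unfolding connected_in_def by auto

lemma connected_in_invariant: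
  assumes "(x, y) \<in> connected_in S" and "\<And>u v. {u, v} \<in> S \<Longrightarrow> f u = f v"
  shows "f x = f y"
  using assms(1) unfolding connected_in_def
  by (induction rule: rtrancl_induct) (use assms(2) in auto)

lemma connected_in_crosses:
  assumes "(x, y) \<in> connected_in S" "x \<in> U" "y \<notin> U"
  obtains u v where "{u, v} \<in> S" "(x, u) \<in> connected_in S" "u \<in> U" "v \<notin> U"
proof -
  have "y \<in> U \<or> (\<exists>u v. {u, v} \<in> S \<and> (x, u) \<in> connected_in S \<and> u \<in> U \<and> v \<notin> U)"
    using assms(1) unfolding connected_in_def
  proof (induction rule: rtrancl_induct)
    case base
    then show ?case using assms(2) by simp
  next
    case (step y z)
    then show ?case by blast
  qed
  then show thesis using assms(3) that by blast
qed

text \<open>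
  An induced node partition therefore determines which pairs of nodes are connected.
\<close>

lemma quotient_eq_imp_eq:
  assumes "equiv X R" "equiv X R'" "X // R = X // R'"
  shows "R = R'"
proof -
  have "R \<subseteq> R'" if "equiv X R" "equiv X R'" "X // R = X // R'" for R R' :: "('a \<times> 'a) set"
  proof clarify
    fix x y assume xy: "(x, y) \<in> R"
    then have xX: "x \<in> X" "y \<in> X" using that(1) equiv_class_eq_iff by metis+
    then have "R `` {x} \<in> X // R'" using that(3) by (metis quotientI)
    then obtain z where z: "R `` {x} = R' `` {z}" by (metis quotientE)
    have "x \<in> R `` {x}" "y \<in> R `` {x}" using xy xX that(1) equiv_class_self by fast+
    then have "(z, x) \<in> R'" "(z, y) \<in> R'" using z by auto
    then show "(x, y) \<in> R'" using that(2) by (meson equivE symD transD)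
  qed
  then show ?thesis using assms by (metis subset_antisym)
qed

lemma quotient_eqI:
  assumes "\<And>q. q \<in> Q \<Longrightarrow> q \<noteq> {}" and "\<Union>Q = X"
    and "\<And>q k. q \<in> Q \<Longrightarrow> k \<in> q \<Longrightarrow> R `` {k} = q"
  shows "X // R = Q"
proof
  show "X // R \<subseteq> Q"
    using assms(2,3) by (auto elim!: quotientE)
  show "Q \<subseteq> X // R"
  proof
    fix q assume "q \<in> Q"
    moreover from this obtain k where "k \<in> q" using assms(1) by blast
    ultimately show "q \<in> X // R" using assms(2,3) by (metis UnionI quotientI)
  qed
qed

lemma equiv_kernel: "equiv X {(k, l) \<in> X \<times> X. f k = f l}"
  by (auto simp: equiv_def refl_on_def sym_def trans_def)

section \<open>Cuts along grid lines\<close>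

text \<open>
  \<open>cut (True, t)\<close> is bounded by the horizontal grid line below row \<open>t\<close>, and \<open>cut (False, t)\<close> by the
  vertical grid line to the right of column \<open>t\<close>.
\<close>

fun cut :: "bool \<times> nat \<Rightarrow> vertex set" where
  "cut (b, t) = {v. (if b then fst v else snd v) \<le> t}"

definition crosses :: "vertex set \<Rightarrow> vertex set \<Rightarrow> bool" where
  "crosses U e \<longleftrightarrow> \<not> e \<subseteq> U \<and> \<not> e \<subseteq> - U"

lemma edges_cases:
  assumes "e \<in> edges n"
  obtains (vertical) r c where "e = {(r, c), (r + 1, c)}" "(r, c) \<in> vertices n" "(r + 1, c) \<in> vertices n"
    | (horizontal) r c where "e = {(r, c), (r, c + 1)}" "(r, c) \<in> vertices n" "(r, c + 1) \<in> vertices n"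
  using assms unfolding edges_def by blast

lemma crosses_unique:
  assumes "e \<in> edges n" "crosses (cut k) e" "crosses (cut k') e"
  shows "k = k'"
  using assms(1)
proof (cases rule: edges_cases)
  case (vertical r c)
  then show ?thesis using assms(2,3)
    by (cases k; cases k') (auto simp: crosses_def split: if_splits)
next
  case (horizontal r c)
  then show ?thesis using assms(2,3)
    by (cases k; cases k') (auto simp: crosses_def split: if_splits)
qed

lemma edges_subset: "e \<in> edges n \<Longrightarrow> e \<subseteq> vertices n"
  by (auto simp: edges_def)

lemma edges_doubleton:
  assumes "e \<in> edges n" obtains u v where "u \<noteq> v" "e = {u, v}"
  using assms by (cases rule: edges_cases) (metis n_not_Suc_n Suc_eq_plus1 prod.inject)+

lemma finite_vertices: "finite (vertices n)"
  by (rule finite_subset[of _ "{0..n} \<times> {0..n}"]) (auto simp: vertices_def)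

lemma vertices_iff: "(r, c) \<in> vertices n \<longleftrightarrow> 1 \<le> c \<and> c \<le> r \<and> r + c \<le> n + 1"
  by (auto simp: vertices_def)

lemma node_in_vertices: "k \<in> {1..n} \<Longrightarrow> node n k \<in> vertices n"
  by (auto simp: node_def vertices_def)

section \<open>The explicit grove of a center\<close>

text \<open>
  The center is the point where the antidiagonal \<open>row + column = A\<close> meets the diagonal
  \<open>row - column = B\<close>. For the vertex \<open>(i, j)\<close> this means \<open>A = i + j\<close> and \<open>B = i - j\<close>; the midpoint of the
  square \<open>(i, j)\<close> has \<open>A = i + j + 1\<close> and \<open>B = i - j\<close>. The column of the center is \<open>(A - B) / 2\<close>.
\<close>

locale center =
  fixes n A B :: nat
  assumes BA: "B < A" and An: "A \<le> n + 1"
begin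

text \<open>
  The trees are rooted on the two diagonals. A vertex above or below both of them
  moves vertically, and a vertex in the wedge to the right of the center moves to the left.
  In the columns to the left of the center, where the antidiagonal lies below the diagonal,
  every vertex moves to the antidiagonal, so that the whole column is one tree.
\<close>

fun parent :: "vertex \<Rightarrow> vertex" where
  "parent (r, c) =
    (if r + c < A then (r + 1, c)
     else if A < r + c \<and> B + c < r then (r - 1, c)
     else if A < r + c \<and> r < B + c then (r, c - 1)
     else (r, c))"

text \<open>
  The end of the chain of parents, in closed form. Its column is the leftmost column that the tree
  meets; it serves as the label of the tree. In \<open>max (A - r) (r - B)\<close> truncated subtraction
  is harmless because \<open>B < A\<close> makes one of the two differences positive.
\<close>

fun root :: "vertex \<Rightarrow> vertex" where
  "root (r, c) =
    (if r + c \<le> A then (A - c, c)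
     else if B + c \<le> r then (max (A - c) (B + c), c)
     else (r, max (A - r) (r - B)))"

text \<open>
  Any measure that drops along \<open>parent\<close> would do: it makes the graph acyclic and makes induction
  towards the roots possible.
\<close>

fun height :: "vertex \<Rightarrow> nat" where
  "height (r, c) =
    (if A < r + c \<and> r < B + c then c
     else if r + c \<le> A then A - (r + c)
     else r - max (A - c) (B + c))"

fun parent_cut :: "vertex \<Rightarrow> bool \<times> nat" where
  "parent_cut (r, c) =
    (if r + c < A then (True, r)
     else if B + c < r then (True, r - 1)
     else (False, c - 1))"

definition forest :: "vertex set set" where
  "forest = (\<lambda>x. {x, parent x}) ` {x \<in> vertices n. parent x \<noteq> x}"

definition node_classes :: "nat set set" where
  "node_classes = {1..n} // {(k, l) \<in> {1..n} \<times> {1..n}. root (node n k) = root (node n l)}"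

lemma parent_cases:
  assumes "x \<in> vertices n" "parent x \<noteq> x"
  obtains (down) r c where "x = (r, c)" "1 \<le> c" "c \<le> r" "r + c \<le> n + 1" "r + c < A"
      "parent x = (r + 1, c)" "root x = (A - c, c)" "parent_cut x = (True, r)"
    | (up) r c where "x = (r, c)" "1 \<le> c" "c \<le> r" "r + c \<le> n + 1" "A < r + c" "B + c < r"
      "parent x = (r - 1, c)" "root x = (max (A - c) (B + c), c)" "parent_cut x = (True, r - 1)"
    | (left) r c where "x = (r, c)" "2 \<le> c" "c \<le> r" "r + c \<le> n + 1" "A < r + c" "r < B + c"
      "parent x = (r, c - 1)" "root x = (r, max (A - r) (r - B))" "max (A - r) (r - B) < c"
      "parent_cut x = (False, c - 1)"
proof -
  obtain r c where x: "x = (r, c)" by (rule prod.exhaust)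
  have v: "1 \<le> c" "c \<le> r" "r + c \<le> n + 1" using assms(1) unfolding x vertices_iff by blast+
  have "r + c < A \<or> (A < r + c \<and> B + c < r) \<or> (A < r + c \<and> r < B + c)"
    using assms(2) by (simp add: x split: if_splits)
  then consider "r + c < A" | "A < r + c" "B + c < r" | "A < r + c" "r < B + c" by blast
  then show thesis
  proof cases
    case 1
    then show thesis using v by (intro down[of r c]) (auto simp: x)
  next
    case 2
    then show thesis using v by (intro up[of r c]) (auto simp: x)
  next
    case 3
    then show thesis using v BA by (intro left[of r c]) (auto simp: x)
  qed
qed

lemma parent_edge:
  assumes "x \<in> vertices n" "parent x \<noteq> x"
  shows "{x, parent x} \<in> edges n"
  using assms
proof (cases rule: parent_cases)
  case (down r c)
  then have "{x, parent x} = {(r, c), (r + 1, c)}" "(r + 1, c) \<in> vertices n"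
    using An by (auto simp: vertices_iff)
  then show ?thesis using assms(1) down(1) unfolding edges_def by blast
next
  case (up r c)
  then have "{x, parent x} = {(r - 1, c), (r - 1 + 1, c)}" "(r - 1, c) \<in> vertices n" "r - 1 + 1 = r"
    by (auto simp: vertices_iff)
  then show ?thesis using assms(1) up(1) unfolding edges_def by fastforce
next
  case (left r c)
  then have "{x, parent x} = {(r, c - 1), (r, c - 1 + 1)}" "(r, c - 1) \<in> vertices n" "c - 1 + 1 = c"
    by (auto simp: vertices_iff)
  then show ?thesis using assms(1) left(1) unfolding edges_def by fastforce
qed

lemma parent_in_vertices: "x \<in> vertices n \<Longrightarrow> parent x \<in> vertices n"
  using parent_edge[of x] edges_subset by (cases "parent x = x") (simp, blast)

lemma forest_subset: "forest \<subseteq> edges n"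
  using parent_edge by (auto simp: forest_def)

lemma height_parent:
  assumes "x \<in> vertices n" "parent x \<noteq> x"
  shows "height (parent x) < height x"
  using assms
proof (cases rule: parent_cases)
  case (up r c)
  then have "max (A - c) (B + c) < r" by simp
  then show ?thesis using up by auto
qed auto

lemma root_parent: "x \<in> vertices n \<Longrightarrow> root (parent x) = root x"
proof (cases "parent x = x")
  case False
  assume "x \<in> vertices n"
  then show ?thesis
    using False
  proof (cases rule: parent_cases)
    case (down r c)
    then show ?thesis by simp
  next
    case (up r c)
    then show ?thesis by (cases "r - 1 + c = A") auto
  next
    case (left r c)
    then consider "r + (c - 1) = A" | "A < r + (c - 1)" "r = B + (c - 1)" | "A < r + (c - 1)" "r < B + (c - 1)"
      by linarith
    then show ?thesis by cases (use left in auto)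
  qed
qed simp

lemma vertex_cases:
  assumes "x \<in> vertices n"
  obtains (upper) r c where "x = (r, c)" "1 \<le> c" "c \<le> r" "r + c \<le> n + 1" "r + c \<le> A"
      "root x = (A - c, c)"
    | (lower) r c where "x = (r, c)" "1 \<le> c" "c \<le> r" "r + c \<le> n + 1" "A < r + c" "B + c \<le> r"
      "root x = (max (A - c) (B + c), c)"
    | (inner) r c where "x = (r, c)" "1 \<le> c" "c \<le> r" "r + c \<le> n + 1" "A < r + c" "r < B + c"
      "root x = (r, max (A - r) (r - B))"
proof -
  obtain r c where x: "x = (r, c)" by (rule prod.exhaust)
  have v: "1 \<le> c" "c \<le> r" "r + c \<le> n + 1" using assms(1) unfolding x vertices_iff by blast+
  consider "r + c \<le> A" | "A < r + c" "B + c \<le> r" | "A < r + c" "r < B + c" by linarith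
  then show thesis
  proof cases
    case 1
    then show thesis using v by (intro upper[of r c]) (simp_all add: x)
  next
    case 2
    then show thesis using v by (intro lower[of r c]) (simp_all add: x)
  next
    case 3
    then show thesis using v by (intro inner[of r c]) (simp_all add: x)
  qed
qed

lemma root_in_vertices:
  assumes "x \<in> vertices n"
  shows "root x \<in> vertices n"
  using assms
proof (cases rule: vertex_cases)
  case (upper r c)
  then show ?thesis using An by (auto simp: vertices_iff)
next
  case (lower r c)
  then show ?thesis by (cases "A - c \<le> B + c") (auto simp: vertices_iff)
next
  case (inner r c)
  then show ?thesis using BA by (auto simp: vertices_iff)
qed

lemma root_cases:
  assumes "x \<in> vertices n"
  obtains "fst (root x) + snd (root x) = A"
    | "A < fst (root x) + snd (root x)" "fst (root x) = B + snd (root x)"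
  using assms
proof (cases rule: vertex_cases)
  case (upper r c)
  then show thesis using that(1) An by simp
next
  case (lower r c)
  then show thesis using that by (cases "B + c \<le> A - c") auto
next
  case (inner r c)
  then consider "r - B \<le> A - r" "r \<le> A" | "A - r < r - B" "B < r" using BA by linarith
  then show thesis by cases (use inner that in \<open>auto simp: max_def\<close>)
qed

lemma parent_root:
  assumes "x \<in> vertices n"
  shows "parent (root x) = root x"
proof -
  obtain s l where P: "root x = (s, l)" by (cases "root x")
  show ?thesis by (rule root_cases[OF assms]) (simp_all add: P)
qed

lemma root_root:
  assumes "x \<in> vertices n"
  shows "root (root x) = root x"
proof -
  obtain s l where P: "root x = (s, l)" by (cases "root x")
  show ?thesis by (rule root_cases[OF assms]) (simp_all add: P, linarith?)
qed

lemma root_eq_iff: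
  assumes "x \<in> vertices n"
  shows "root x = x \<longleftrightarrow> parent x = x"
proof
  assume "root x = x"
  then show "parent x = x" using parent_root[OF assms] by simp
next
  assume fixed: "parent x = x"
  show "root x = x"
    using assms by (cases rule: vertex_cases) (use fixed in \<open>auto split: if_splits\<close>)
qed

lemma node_extreme:
  assumes "(r, c) \<in> vertices n"
  shows "node n c = (c, c)" "node n (Suc n - c) = (Suc n - c, c)"
  using assms by (auto simp: node_def vertices_iff)

text \<open>
  The column of a root on the antidiagonal has its top node in the same tree, the column of a root
  on the diagonal its bottom node.
\<close>

lemma root_node:
  assumes "x \<in> vertices n"
  obtains k where "k \<in> {1..n}" "root (node n k) = root x" "snd (node n k) = snd (root x)"
    "fst (root x) + snd (root x) = A \<Longrightarrow> k \<le> fst (root x)"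
    "A < fst (root x) + snd (root x) \<Longrightarrow> fst (root x) \<le> k"
proof -
  obtain s l where P: "root x = (s, l)" by (cases "root x")
  have root_vertex: "(s, l) \<in> vertices n" using root_in_vertices[OF assms] P by simp
  note node_extreme = node_extreme[OF this]
  have v: "1 \<le> l" "l \<le> s" "s + l \<le> n + 1"
    using root_vertex unfolding vertices_iff by blast+
  consider "s + l = A" | "A < s + l" "s = B + l"
    by (rule root_cases[OF assms]) (simp_all add: P)
  then show thesis
  proof cases
    case 1
    then show thesis using v node_extreme by (intro that[of l]) (auto simp: P)
  next
    case 2
    then show thesis using v node_extreme by (intro that[of "n + 1 - l"]) (auto simp: P)
  qed
qed

text \<open>
  This is what makes the forest rigid: each of its edges crosses a grid line that any connected
  graph containing the nodes of its part has to cross.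
\<close>

lemma parent_cut_separates:
  assumes "x \<in> vertices n" "parent x \<noteq> x"
  obtains k l where "k \<in> {1..n}" "l \<in> {1..n}" "root (node n k) = root x" "root (node n l) = root x"
    "node n k \<in> cut (parent_cut x)" "node n l \<notin> cut (parent_cut x)"
  using assms
proof (cases rule: parent_cases)
  case (down r c)
  note top = node_extreme[OF assms(1)[unfolded down(1)]]
  show thesis
  proof (cases "B + 2 * c \<le> A")
    case True
    show thesis
      by (rule that[of c "n + 1 - c"]) (use down(2-5) True An in \<open>auto simp: top down(7,8)\<close>)
  next
    case False
    define m where "m = min (A - c) (n + 1 - (A - c))"
    have m: "node n (A - c) = (A - c, m)" "c \<le> m" "m \<le> A - c"
      using down(2-5) An by (auto simp: node_def m_def)
    have roots: "root (A - c, m) = (A - c, c)" using down(2-5) False m by (cases "m = c") auto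
    have root_top: "root (c, c) = (A - c, c)" using down(3,5) by simp
    note top = top m(1) roots root_top
    show thesis
      by (rule that[of c "A - c"]) (use down(2-5) An in \<open>auto simp: top down(7,8) simp del: root.simps\<close>)
  qed
next
  case (up r c)
  note top = node_extreme[OF assms(1)[unfolded up(1)]]
  show thesis
  proof (cases "B + 2 * c \<le> A")
    case True
    show thesis
      by (rule that[of c "n + 1 - c"]) (use up(2-6) True An in \<open>auto simp: top up(8,9)\<close>)
  next
    case False
    define m where "m = min (B + c) (n + 1 - (B + c))"
    have m: "node n (B + c) = (B + c, m)" "c \<le> m" "m \<le> B + c"
      using up(2-6) by (auto simp: node_def m_def)
    have roots: "root (B + c, m) = (B + c, c)" using up(2-6) False m by (cases "m = c") auto
    have max: "max (A - c) (B + c) = B + c" using False by simp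
    have root_bottom: "root (Suc n - c, c) = (B + c, c)" using up(2-6) False by auto
    note top = top m(1) roots max root_bottom
    show thesis
      by (rule that[of "B + c" "n + 1 - c"]) (use up(2-6) in \<open>auto simp: top up(8,9) simp del: root.simps\<close>)
  qed
next
  case (left r c)
  obtain k where k: "k \<in> {1..n}" "root (node n k) = root x" "snd (node n k) = snd (root x)"
    using root_node[OF assms(1)] .
  obtain m where m: "node n r = (r, m)" "c \<le> m" using left(3,4) by (simp add: node_def)
  have "root (r, m) = root x" using left m by auto
  then show thesis using left k m by (intro that[of k r]) auto
qed

text \<open>
  A tree crosses each grid line at most once: its vertical edges lie in the column of the root, its
  horizontal edges in the row of the root.
\<close>

lemma parent_cut_inj:
  assumes "x \<in> vertices n" "parent x \<noteq> x" "y \<in> vertices n" "parent y \<noteq> y"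
    and "root x = root y" "parent_cut x = parent_cut y"
  shows "x = y"
  using assms(1,2)
  by (cases rule: parent_cases; use assms(3,4) in \<open>cases rule: parent_cases\<close>; use assms(5,6) in simp)

lemma parent_cut_crosses:
  assumes "x \<in> vertices n" "parent x \<noteq> x"
  shows "crosses (cut (parent_cut x)) {x, parent x}"
  using assms by (cases rule: parent_cases) (simp_all add: crosses_def)

text \<open>
  A tree crosses no grid line to the left of its root. It crosses none below its root if it lies
  above the center, and none above its root if it lies below the center.
\<close>

lemma parent_cut_column:
  assumes "x \<in> vertices n" "parent x \<noteq> x" "parent_cut x = (False, t)"
  shows "snd (root x) \<le> t"
  using assms(1,2) by (cases rule: parent_cases) (use assms(3) in auto)

lemma parent_cut_upper:
  assumes "x \<in> vertices n" "parent x \<noteq> x" "parent_cut x = (True, t)"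
    and "root x = (s, l)" "s + l = A" "A < B + 2 * l"
  shows "t < s"
  using assms(1,2) by (cases rule: parent_cases) (use assms(3-6) in auto)

lemma parent_cut_lower:
  assumes "x \<in> vertices n" "parent x \<noteq> x" "parent_cut x = (True, t)"
    and "root x = (s, l)" "A < s + l"
  shows "s \<le> t"
  using assms(1,2) by (cases rule: parent_cases) (use assms(3-5) in \<open>auto simp: max_def split: if_splits\<close>)

text \<open>
  Both neighbors of a highest vertex on a cycle would be its parent.
\<close>

lemma forest_acyclic: "\<not> is_cycle forest p"
proof
  assume cyc: "is_cycle forest p"
  let ?m = "length p"
  have m: "3 \<le> ?m" "distinct p" and E: "\<And>k. k < ?m \<Longrightarrow> {p ! k, p ! ((k + 1) mod ?m)} \<in> forest"
    using cyc by (auto simp: is_cycle_def)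
  have step: "y = parent x" if edge: "{x, y} \<in> forest" and le: "height y \<le> height x" for x y
  proof -
    obtain z where z: "z \<in> vertices n" "parent z \<noteq> z" "{x, y} = {z, parent z}"
      using edge unfolding forest_def by blast
    moreover have "\<not> (x = parent z \<and> y = z)"
      using le height_parent[OF z(1,2)] by (metis leD)
    ultimately show ?thesis by (metis doubleton_eq_iff)
  qed
  have "p \<noteq> []" using m by auto
  then have "Max (height ` set p) \<in> height ` set p" by (intro Max_in) auto
  then obtain x where x: "x \<in> set p" "height x = Max (height ` set p)" by (metis imageE)
  then obtain k where k: "k < ?m" "p ! k = x" by (metis in_set_conv_nth)
  have highest: "height y \<le> height (p ! k)" if "y \<in> set p" for y
    unfolding k(2) x(2) using that by (intro Max_ge imageI) auto
  let ?s = "(k + 1) mod ?m" and ?q = "(k + ?m - 1) mod ?m"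
  have lt: "?s < ?m" "?q < ?m" using mod_less_divisor[of ?m] k(1) by (metis gr_implies_not0 neq0_conv)+
  have "p ! ?s = parent (p ! k)"
    using step[OF E[OF k(1)] highest[OF nth_mem[OF lt(1)]]] .
  moreover have "p ! ?q = parent (p ! k)"
  proof -
    have "?q + 1 = k \<or> (k = 0 \<and> ?q + 1 = ?m)" using k(1) m(1) by (cases k) auto
    then have "(?q + 1) mod ?m = k" using k(1) by auto
    then have "{p ! k, p ! ?q} \<in> forest" using E[OF lt(2)] by (simp add: insert_commute)
    then show ?thesis by (rule step) (rule highest[OF nth_mem[OF lt(2)]])
  qed
  ultimately have "?s = ?q" using m(2) lt by (metis nth_eq_iff_index_eq)
  moreover have "?s \<noteq> ?q"
  proof (cases "k = 0")
    case True
    then show ?thesis using m(1) by simp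
  next
    case False
    then have "?q = k - 1" using k(1) by (simp add: mod_if)
    then show ?thesis using False k(1) m(1) by (cases "k + 1 = ?m") auto
  qed
  ultimately show False by simp
qed

lemma connected_root: "x \<in> vertices n \<Longrightarrow> (x, root x) \<in> connected_in forest"
proof (induction "height x" arbitrary: x rule: less_induct)
  case less
  show ?case
  proof (cases "parent x = x")
    case True
    then have "root x = x" using root_eq_iff less.prems by blast
    then show ?thesis by (metis connected_in_refl)
  next
    case False
    have "(x, parent x) \<in> connected_in forest"
      using False less.prems unfolding forest_def by (intro connected_in_edge) blast
    moreover have "(parent x, root x) \<in> connected_in forest"
      using less.hyps[of "parent x"] False less.prems height_parent parent_in_vertices root_parent
      by metis
    ultimately show ?thesis by (rule connected_in_trans)
  qed
qed

lemma forest_edge_root: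
  assumes "{u, v} \<in> forest"
  shows "root u = root v"
proof -
  obtain z where z: "z \<in> vertices n" "{u, v} = {z, parent z}"
    using assms unfolding forest_def by blast
  then consider "u = z" "v = parent z" | "u = parent z" "v = z"
    unfolding doubleton_eq_iff by blast
  then show ?thesis by cases (simp_all only: root_parent[OF z(1)])
qed

lemma connected_iff_root:
  assumes "x \<in> vertices n" "y \<in> vertices n"
  shows "(x, y) \<in> connected_in forest \<longleftrightarrow> root x = root y"
proof
  assume "(x, y) \<in> connected_in forest"
  then show "root x = root y"
    by (rule connected_in_invariant[where f = root]) (rule forest_edge_root)
next
  assume eq: "root x = root y"
  have "(y, root x) \<in> connected_in forest" unfolding eq by (rule connected_root[OF assms(2)])
  then have "(root x, y) \<in> connected_in forest" by (rule connected_in_sym)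
  with connected_root[OF assms(1)] show "(x, y) \<in> connected_in forest"
    by (rule connected_in_trans)
qed

lemma forest_grove: "grove n forest"
  unfolding grove_def
proof (intro conjI ballI)
  show "forest \<subseteq> edges n" by (rule forest_subset)
  show "\<nexists>p. is_cycle forest p" using forest_acyclic by blast
  fix v assume v: "v \<in> vertices n"
  obtain k where "k \<in> {1..n}" "root (node n k) = root v"
    using root_node[OF v] .
  then show "\<exists>k\<in>{1..n}. (v, node n k) \<in> connected_in forest"
    using connected_iff_root v node_in_vertices by metis
qed

lemma node_partition_forest: "node_partition n forest = node_classes"
proof -
  have "{(k, l) \<in> {1..n} \<times> {1..n}. (node n k, node n l) \<in> connected_in forest} =
        {(k, l) \<in> {1..n} \<times> {1..n}. root (node n k) = root (node n l)}"
    using connected_iff_root[OF node_in_vertices node_in_vertices] by blast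
  then show ?thesis by (simp add: node_partition_def node_classes_def)
qed

lemma forest_edgeI: "x \<in> vertices n \<Longrightarrow> parent x = y \<Longrightarrow> x \<noteq> y \<Longrightarrow> {x, y} \<in> forest"
  unfolding forest_def by (rule image_eqI[where x = x]) simp_all

text \<open>
  The trees are induced subgraphs. For a competing grove it is therefore enough to know that its
  trees have the same vertex sets.
\<close>

lemma same_root_edge_in_forest:
  assumes "e \<in> edges n" "\<And>x y. x \<in> e \<Longrightarrow> y \<in> e \<Longrightarrow> root x = root y"
  shows "e \<in> forest"
  using assms(1)
proof (cases rule: edges_cases)
  case (vertical r c)
  have eq: "root (r, c) = root (r + 1, c)" using assms(2) vertical by blast
  have "parent (r, c) = (r + 1, c) \<or> parent (r + 1, c) = (r, c)"
  proof (rule ccontr)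
    assume "\<not> ?thesis"
    then have "A \<le> r + c" "r < B + c" by (auto split: if_splits)
    moreover from this have "fst (root (r, c)) = r" by auto
    moreover have "fst (root (r + 1, c)) = r + 1"
      using \<open>A \<le> r + c\<close> \<open>r < B + c\<close> by (cases "r + 1 = B + c") auto
    ultimately show False using eq by simp
  qed
  then show ?thesis
    using forest_edgeI[OF vertical(2)] forest_edgeI[OF vertical(3)] vertical(1)
    by (auto simp: insert_commute simp del: parent.simps)
next
  case (horizontal r c)
  have eq: "root (r, c) = root (r, c + 1)" using assms(2) horizontal by blast
  have "parent (r, c + 1) = (r, c)"
  proof (rule ccontr)
    assume "\<not> ?thesis"
    then have "r + c < A \<or> (A \<le> r + c \<and> B + c < r)" by (auto split: if_splits)
    then have "snd (root (r, c)) = c" "snd (root (r, c + 1)) = c + 1" by auto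
    then show False using eq by simp
  qed
  then show ?thesis
    using forest_edgeI[OF horizontal(3)] horizontal(1)
    by (auto simp: insert_commute simp del: parent.simps)
qed

section \<open>Uniqueness of the grove\<close>

text \<open>
  For \<open>v = (r, c)\<close> the label \<open>snd (root v)\<close> is the minimum of \<open>c\<close> and \<open>max (A - r) (r - B)\<close>. A tree
  with label \<open>l\<close> that reaches \<open>v\<close> without leaving the rows and columns allowed to it needs \<open>l \<le> c\<close> and,
  above or below the center, \<open>l \<le> A - r\<close> or \<open>l \<le> r - B\<close>. To the left of the center there is no
  constraint on the rows, but there \<open>l\<close> is at most \<open>(A - B) / 2\<close>, the least value of that maximum.
\<close>

lemma class_label_bound:
  assumes "v \<in> vertices n" "w \<in> vertices n" "root w = (s, l)"
    and column: "l \<le> snd v"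
    and upper: "s + l = A \<Longrightarrow> A < B + 2 * l \<Longrightarrow> fst v \<le> s"
    and lower: "A < s + l \<Longrightarrow> s \<le> fst v"
  shows "l \<le> snd (root v)" and "l = snd (root v) \<Longrightarrow> root v = (s, l)"
proof -
  consider (up) "s + l = A" "A < B + 2 * l" | (through) "s + l = A" "B + 2 * l \<le> A"
    | (low) "A < s + l" "s = B + l"
    using root_cases[OF assms(2)] assms(3) by fastforce
  note P = this
  have "l \<le> snd (root v) \<and> (l = snd (root v) \<longrightarrow> root v = (s, l))"
    using assms(1)
  proof (cases rule: vertex_cases)
    case v: (upper r c)
    show ?thesis using P by cases (use v column lower in auto)
  next
    case v: (lower r c)
    show ?thesis using P
    proof cases
      case up
      then have False using v upper column by auto
      then show ?thesis ..
    qed (use v column in auto)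
  next
    case v: (inner r c)
    show ?thesis using P
    proof cases
      case up
      then have "l \<le> A - r" "r \<le> A" using upper v by auto
      then show ?thesis using v up by (auto simp: max_def)
    next
      case through
      have "A - B \<le> (A - r) + (r - B)" by simp
      then have "l \<le> max (A - r) (r - B)" using through by linarith
      moreover have "r = s" if "l = max (A - r) (r - B)"
        using that through v by linarith
      ultimately show ?thesis using v by auto
    next
      case low
      then have "l \<le> r - B" "B \<le> r" using lower v by auto
      then show ?thesis using v low by (auto simp: max_def)
    qed
  qed
  then show "l \<le> snd (root v)" and "l = snd (root v) \<Longrightarrow> root v = (s, l)" by auto
qed

text \<open>
  The part of the nodes connected to \<open>x\<close> in \<open>S\<close>, represented by the root of the tree in \<open>forest\<close>
  that contains them.
\<close>

definition class_of :: "vertex set set \<Rightarrow> vertex \<Rightarrow> vertex" where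
  "class_of S x = root (node n (SOME k. k \<in> {1..n} \<and> (x, node n k) \<in> connected_in S))"

lemma node_connected_iff_root:
  assumes "node_partition n S = node_classes" "k \<in> {1..n}" "l \<in> {1..n}"
  shows "(node n k, node n l) \<in> connected_in S \<longleftrightarrow> root (node n k) = root (node n l)"
proof -
  let ?R = "{(k, l) \<in> {1..n} \<times> {1..n}. (node n k, node n l) \<in> connected_in S}"
  let ?R' = "{(k, l) \<in> {1..n} \<times> {1..n}. root (node n k) = root (node n l)}"
  have "equiv {1..n} ?R"
    by (auto simp: equiv_def refl_on_def sym_def trans_def
        intro: connected_in_sym connected_in_trans)
  then have "?R = ?R'"
    by (rule quotient_eq_imp_eq[OF _ equiv_kernel
          assms(1)[unfolded node_partition_def node_classes_def]])
  then show ?thesis using assms(2,3) by blast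
qed

end

locale competitor = center +
  fixes S :: "vertex set set"
  assumes grove: "grove n S" and partition: "node_partition n S = node_classes"
begin

lemma S_edges: "S \<subseteq> edges n"
  using grove by (simp add: grove_def)

lemma S_vertices: "{u, v} \<in> S \<Longrightarrow> u \<in> vertices n \<and> v \<in> vertices n"
  using S_edges edges_subset by blast

lemma class_of_witness:
  assumes "x \<in> vertices n"
  obtains k where "k \<in> {1..n}" "(x, node n k) \<in> connected_in S" "class_of S x = root (node n k)"
proof -
  have "\<exists>k. k \<in> {1..n} \<and> (x, node n k) \<in> connected_in S"
    using grove assms unfolding grove_def by blast
  from someI_ex[OF this] show thesis using that unfolding class_of_def by blast
qed

lemma connected_iff_class:
  assumes "x \<in> vertices n" "y \<in> vertices n"
  shows "(x, y) \<in> connected_in S \<longleftrightarrow> class_of S x = class_of S y"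
proof -
  obtain k where k: "k \<in> {1..n}" "(x, node n k) \<in> connected_in S" "class_of S x = root (node n k)"
    using class_of_witness assms by blast
  obtain l where l: "l \<in> {1..n}" "(y, node n l) \<in> connected_in S" "class_of S y = root (node n l)"
    using class_of_witness assms by blast
  have "(x, y) \<in> connected_in S \<longleftrightarrow> (node n k, node n l) \<in> connected_in S"
    using k(2) l(2) connected_in_sym connected_in_trans by metis
  then show ?thesis using node_connected_iff_root[OF partition k(1) l(1)] k(3) l(3) by metis
qed

lemma class_of_node:
  assumes "k \<in> {1..n}"
  shows "class_of S (node n k) = root (node n k)"
proof -
  obtain l where "l \<in> {1..n}" "(node n k, node n l) \<in> connected_in S" "class_of S (node n k) = root (node n l)"
    using class_of_witness node_in_vertices assms by blast
  then show ?thesis using node_connected_iff_root[OF partition assms] by metis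
qed

lemma class_of_root: "x \<in> vertices n \<Longrightarrow> class_of S x \<in> root ` vertices n"
  using class_of_witness node_in_vertices by (metis imageI)

definition tree :: "vertex \<Rightarrow> vertex set" where
  "tree P = {x \<in> vertices n. class_of S x = P}"

definition tree_edges :: "vertex \<Rightarrow> vertex set set" where
  "tree_edges P = {e \<in> S. e \<subseteq> tree P}"

definition nonroots :: "vertex \<Rightarrow> vertex set" where
  "nonroots P = {x \<in> vertices n. parent x \<noteq> x \<and> root x = P}"

lemma finite_tree: "finite (tree P)"
  using finite_vertices by (simp add: tree_def)

lemma finite_tree_edges: "finite (tree_edges P)"
  using finite_subset[OF S_edges finite_edges] by (simp add: tree_edges_def)

lemma card_tree_edges:
  assumes "P \<in> root ` vertices n"
  shows "card (tree_edges P) < card (tree P)"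
proof (rule acyclic_card_edges)
  show "finite (tree P)" by (rule finite_tree)
  obtain x where x: "x \<in> vertices n" "P = root x" using assms by blast
  obtain k where "k \<in> {1..n}" "root (node n k) = root x" using root_node[OF x(1)] .
  then have "node n k \<in> tree P" using x class_of_node node_in_vertices by (simp add: tree_def)
  then show "tree P \<noteq> {}" by blast
  show "\<exists>u\<in>tree P. \<exists>v\<in>tree P. u \<noteq> v \<and> e = {u, v}" if e: "e \<in> tree_edges P" for e
  proof -
    have "e \<in> edges n" "e \<subseteq> tree P" using e S_edges by (auto simp: tree_edges_def)
    then show ?thesis by (metis edges_doubleton insert_subset)
  qed
  show "\<nexists>p. is_cycle (tree_edges P) p"
    using grove unfolding grove_def is_cycle_def tree_edges_def by blast
qed

lemma tree_connected_crosses: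
  assumes "x \<in> tree P" "y \<in> tree P" "x \<in> U" "y \<notin> U"
  shows "\<exists>e\<in>tree_edges P. crosses U e"
proof -
  have "(x, y) \<in> connected_in S"
    using assms connected_iff_class by (auto simp: tree_def)
  then obtain u v where uv: "{u, v} \<in> S" "(x, u) \<in> connected_in S" "u \<in> U" "v \<notin> U"
    using assms(3,4) by (rule connected_in_crosses)
  have V: "u \<in> vertices n" "v \<in> vertices n" using S_vertices uv(1) by blast+
  have "class_of S u = P" using uv(2) connected_iff_class V assms(1) by (simp add: tree_def)
  moreover have "class_of S v = class_of S u"
    using connected_iff_class V connected_in_edge[OF uv(1)] by simp
  ultimately have "{u, v} \<in> tree_edges P" using uv(1) V by (simp add: tree_edges_def tree_def)
  moreover have "crosses U {u, v}" using uv(3,4) by (simp add: crosses_def)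
  ultimately show ?thesis by blast
qed

definition crossing_edge :: "vertex \<Rightarrow> vertex set" where
  "crossing_edge x = (SOME e. e \<in> tree_edges (root x) \<and> crosses (cut (parent_cut x)) e)"

lemma crossing_edge:
  assumes "x \<in> nonroots P"
  shows "crossing_edge x \<in> tree_edges P" "crosses (cut (parent_cut x)) (crossing_edge x)"
proof -
  have x: "x \<in> vertices n" "parent x \<noteq> x" "root x = P" using assms by (simp_all add: nonroots_def)
  obtain k l where kl: "k \<in> {1..n}" "l \<in> {1..n}" "root (node n k) = root x" "root (node n l) = root x"
    "node n k \<in> cut (parent_cut x)" "node n l \<notin> cut (parent_cut x)"
    using parent_cut_separates[OF x(1,2)] .
  then have "node n k \<in> tree P" "node n l \<in> tree P"
    using x(3) class_of_node node_in_vertices by (simp_all add: tree_def)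
  then have "\<exists>e. e \<in> tree_edges P \<and> crosses (cut (parent_cut x)) e"
    using tree_connected_crosses kl(5,6) by blast
  from someI_ex[OF this]
  show "crossing_edge x \<in> tree_edges P" "crosses (cut (parent_cut x)) (crossing_edge x)"
    unfolding crossing_edge_def x(3) by blast+
qed

text \<open>
  An edge crosses only one grid line, and the grid lines \<open>parent_cut x\<close> belonging to one tree are
  pairwise different.
\<close>

lemma inj_crossing_edge: "inj_on crossing_edge (nonroots P)"
proof (rule inj_onI)
  fix x y assume xy: "x \<in> nonroots P" "y \<in> nonroots P" "crossing_edge x = crossing_edge y"
  have "crossing_edge x \<in> edges n" using crossing_edge(1)[OF xy(1)] S_edges by (auto simp: tree_edges_def)
  then have "parent_cut x = parent_cut y"
    using crosses_unique crossing_edge(2) xy by metis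
  with xy(1,2) show "x = y" by - (rule parent_cut_inj, simp_all add: nonroots_def)
qed

lemma card_nonroots:
  assumes "P \<in> root ` vertices n"
  shows "card {x \<in> vertices n. root x = P} = card (nonroots P) + 1"
proof -
  obtain w where w: "w \<in> vertices n" "P = root w" using assms by blast
  have "{x \<in> vertices n. root x = P} = insert P (nonroots P)"
  proof (intro equalityI subsetI)
    fix x assume "x \<in> {x \<in> vertices n. root x = P}"
    then show "x \<in> insert P (nonroots P)" using root_eq_iff[of x] by (simp add: nonroots_def) metis
  next
    fix x assume "x \<in> insert P (nonroots P)"
    then show "x \<in> {x \<in> vertices n. root x = P}"
      using root_in_vertices[OF w(1)] root_root[OF w(1)] by (elim insertE) (simp_all add: nonroots_def w(2))
  qed
  moreover have "P \<notin> nonroots P" using parent_root[OF w(1)] by (simp add: nonroots_def w(2))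
  moreover have "finite (nonroots P)" using finite_vertices by (simp add: nonroots_def)
  ultimately show ?thesis by simp
qed

text \<open>
  Per tree, the edges chosen by \<open>crossing_edge\<close> and acyclicity of \<open>S\<close> give an inequality; both
  families of trees partition all vertices, which forces equality.
\<close>

lemma card_tree:
  assumes "P \<in> root ` vertices n"
  shows "card (tree P) = card {x \<in> vertices n. root x = P}"
proof -
  have le: "card {x \<in> vertices n. root x = P} \<le> card (tree P)" if "P \<in> root ` vertices n" for P
  proof -
    have "card (nonroots P) \<le> card (tree_edges P)"
      by (rule card_inj_on_le[OF inj_crossing_edge _ finite_tree_edges])
        (rule image_subsetI, rule crossing_edge(1))
    then show ?thesis using card_tree_edges[OF that] card_nonroots[OF that] by linarith
  qed
  have "(\<Sum>P\<in>root ` vertices n. card {x \<in> vertices n. root x = P}) = card (vertices n)"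
    using sum.group[of "vertices n" "root ` vertices n" root "\<lambda>_. 1::nat"] finite_vertices by simp
  also have "\<dots> = (\<Sum>P\<in>root ` vertices n. card (tree P))"
    using sum.group[of "vertices n" "root ` vertices n" "class_of S" "\<lambda>_. 1::nat"]
      finite_vertices class_of_root by (simp add: tree_def image_subset_iff)
  finally show ?thesis
    using sum_mono_inv[where f = "\<lambda>P. card {x \<in> vertices n. root x = P}" and g = "\<lambda>P. card (tree P)"
        and I = "root ` vertices n" and i = P] le assms finite_vertices by simp
qed

lemma crossing_edge_image:
  assumes "P \<in> root ` vertices n"
  shows "crossing_edge ` nonroots P = tree_edges P"
proof (rule card_seteq)
  show "finite (tree_edges P)" by (rule finite_tree_edges)
  show "crossing_edge ` nonroots P \<subseteq> tree_edges P" using crossing_edge(1) by blast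
  have "card (tree_edges P) \<le> card (nonroots P)"
    using card_tree_edges[OF assms] card_tree[OF assms] card_nonroots[OF assms] by linarith
  then show "card (tree_edges P) \<le> card (crossing_edge ` nonroots P)"
    by (simp add: card_image inj_crossing_edge)
qed

text \<open>
  Since no edge of \<open>S\<close> is left over, the trees of \<open>S\<close> cross no further grid lines.
\<close>

lemma separated_imp_parent_cut:
  assumes "P \<in> root ` vertices n" "x \<in> tree P" "y \<in> tree P" "x \<in> cut q" "y \<notin> cut q"
  obtains z where "z \<in> vertices n" "parent z \<noteq> z" "root z = P" "parent_cut z = q"
proof -
  obtain e where e: "e \<in> tree_edges P" "crosses (cut q) e"
    using tree_connected_crosses assms(2-5) by blast
  then obtain z where z: "z \<in> nonroots P" "e = crossing_edge z"
    using crossing_edge_image[OF assms(1)] by blast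
  have "e \<in> edges n" using e(1) S_edges by (auto simp: tree_edges_def)
  then have "parent_cut z = q" using crosses_unique e(2) crossing_edge(2)[OF z(1)] z(2) by metis
  with z(1) show thesis unfolding nonroots_def by (intro that[of z]) simp_all
qed

lemma class_of_bounds:
  assumes v: "v \<in> vertices n" and P: "class_of S v = (s, l)"
  shows "l \<le> snd v" "s + l = A \<Longrightarrow> A < B + 2 * l \<Longrightarrow> fst v \<le> s" "A < s + l \<Longrightarrow> s \<le> fst v"
proof -
  have root: "(s, l) \<in> root ` vertices n" using class_of_root[OF v] P by simp
  then obtain w where w: "w \<in> vertices n" "root w = (s, l)" by force
  obtain k where k: "k \<in> {1..n}" "root (node n k) = (s, l)" "snd (node n k) = l"
    "s + l = A \<Longrightarrow> k \<le> s" "A < s + l \<Longrightarrow> s \<le> k"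
    using root_node[OF w(1)] unfolding w(2) fst_conv snd_conv by blast
  have fst_node: "fst (node n k) = k" by (simp add: node_def)
  have tree: "v \<in> tree (s, l)" "node n k \<in> tree (s, l)"
    using v P k(1,2) class_of_node node_in_vertices by (simp_all add: tree_def)
  show "l \<le> snd v"
  proof (rule ccontr)
    assume less: "\<not> l \<le> snd v"
    then have "v \<in> cut (False, l - 1)" "node n k \<notin> cut (False, l - 1)" using k(3) by auto
    then obtain z where "z \<in> vertices n" "parent z \<noteq> z" "root z = (s, l)" "parent_cut z = (False, l - 1)"
      using separated_imp_parent_cut[OF root tree] by blast
    then have "l \<le> l - 1" using parent_cut_column by fastforce
    then show False using less by simp
  qed
  show "fst v \<le> s" if upper: "s + l = A" "A < B + 2 * l"
  proof (rule ccontr)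
    assume less: "\<not> fst v \<le> s"
    then have "node n k \<in> cut (True, s)" "v \<notin> cut (True, s)" using k(4) upper fst_node by auto
    then obtain z where "z \<in> vertices n" "parent z \<noteq> z" "root z = (s, l)" "parent_cut z = (True, s)"
      using separated_imp_parent_cut[OF root tree(2,1)] by blast
    then show False using parent_cut_upper[OF _ _ _ _ upper] by blast
  qed
  show "s \<le> fst v" if lower: "A < s + l"
  proof (rule ccontr)
    assume less: "\<not> s \<le> fst v"
    then have "v \<in> cut (True, s - 1)" "node n k \<notin> cut (True, s - 1)" using k(5) lower fst_node by auto
    then obtain z where "z \<in> vertices n" "parent z \<noteq> z" "root z = (s, l)" "parent_cut z = (True, s - 1)"
      using separated_imp_parent_cut[OF root tree] by blast
    then have "s \<le> s - 1" using parent_cut_lower[OF _ _ _ _ lower] by blast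
    then show False using less by simp
  qed
qed

text \<open>
  The labels are bounded vertex by vertex, and the sums over all vertices are equal because
  corresponding trees have the same label and the same number of vertices.
\<close>

lemma class_of_eq_root:
  assumes "v \<in> vertices n"
  shows "class_of S v = root v"
proof -
  have bound: "snd (class_of S v) \<le> snd (root v)"
      "snd (class_of S v) = snd (root v) \<Longrightarrow> class_of S v = root v" if v: "v \<in> vertices n" for v
  proof -
    obtain s l where P: "class_of S v = (s, l)" by (rule prod.exhaust)
    obtain w where w: "w \<in> vertices n" "root w = (s, l)" using class_of_root[OF v] P by force
    note * = class_label_bound[OF v w class_of_bounds[OF v P]]
    show "snd (class_of S v) \<le> snd (root v)" using *(1) P by simp
    show "class_of S v = root v" if "snd (class_of S v) = snd (root v)"
      using *(2) P that by (metis snd_conv)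
  qed
  have "(\<Sum>v\<in>vertices n. snd (class_of S v)) = (\<Sum>P\<in>root ` vertices n. \<Sum>v\<in>tree P. snd (class_of S v))"
    unfolding tree_def by (rule sum.group[symmetric]) (simp_all add: finite_vertices class_of_root image_subset_iff)
  also have "\<dots> = (\<Sum>P\<in>root ` vertices n. card (tree P) * snd P)"
    by (intro sum.cong) (auto simp: tree_def)
  also have "\<dots> = (\<Sum>P\<in>root ` vertices n. card {v \<in> vertices n. root v = P} * snd P)"
    using card_tree by (intro sum.cong) auto
  also have "\<dots> = (\<Sum>P\<in>root ` vertices n. \<Sum>v\<in>{v \<in> vertices n. root v = P}. snd (root v))"
    by (intro sum.cong) auto
  also have "\<dots> = (\<Sum>v\<in>vertices n. snd (root v))"
    by (rule sum.group) (simp_all add: finite_vertices)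
  finally have "snd (class_of S v) = snd (root v)"
    using sum_mono_inv[where f = "\<lambda>v. snd (class_of S v)" and g = "\<lambda>v. snd (root v)"
        and I = "vertices n" and i = v] bound(1) assms finite_vertices by blast
  then show ?thesis using bound(2) assms by blast
qed

lemma S_eq_forest: "S = forest"
proof
  show sub: "S \<subseteq> forest"
  proof
    fix e assume e: "e \<in> S"
    then have eE: "e \<in> edges n" using S_edges by blast
    obtain u v where uv: "e = {u, v}" using edges_doubleton[OF eE] by blast
    have V: "u \<in> vertices n" "v \<in> vertices n" using S_vertices e uv by blast+
    have "(u, v) \<in> connected_in S" using e uv by (blast intro: connected_in_edge)
    then have "root u = root v" using connected_iff_class class_of_eq_root V by metis
    then show "e \<in> forest" using eE by (intro same_root_edge_in_forest) (auto simp: uv simp del: root.simps)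
  qed
  show "forest \<subseteq> S"
  proof
    fix e assume "e \<in> forest"
    then obtain x where x: "x \<in> vertices n" "parent x \<noteq> x" "e = {x, parent x}"
      unfolding forest_def by blast
    then have off: "x \<in> nonroots (root x)" by (simp add: nonroots_def)
    have f: "crossing_edge x \<in> S" "crossing_edge x \<subseteq> tree (root x)"
      using crossing_edge(1)[OF off] by (simp_all add: tree_edges_def)
    then obtain y where y: "y \<in> vertices n" "parent y \<noteq> y" "crossing_edge x = {y, parent y}"
      using sub unfolding forest_def by blast
    have "root y = root x" using f(2) class_of_eq_root[OF y(1)] y(3) by (simp add: tree_def)
    moreover have "parent_cut y = parent_cut x"
      using crosses_unique[OF parent_edge[OF y(1,2)] parent_cut_crosses[OF y(1,2)]]
        crossing_edge(2)[OF off] y(3) by simp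
    ultimately have "y = x" using parent_cut_inj y x by blast
    then show "e \<in> S" using f(1) y(3) x(3) by simp
  qed
qed

end

context center
begin

lemma Z_eq_prod: "Z n a node_classes = (\<Prod>e\<in>forest. a e)"
proof -
  have "{S. grove n S \<and> node_partition n S = node_classes} = {forest}"
  proof (intro equalityI subsetI)
    fix S assume "S \<in> {S. grove n S \<and> node_partition n S = node_classes}"
    then interpret competitor n A B S by unfold_locales auto
    show "S \<in> {forest}" using S_eq_forest by simp
  qed (use forest_grove node_partition_forest in auto)
  then show ?thesis by (simp add: Z_def)
qed

end

section \<open>The node partitions of vertices and faces\<close>

context center
begin

text \<open>
  The four cases: the top and the bottom node of a column up to the center, and the other nodes
  above and below the center. In the last two cases \<open>max\<close> and \<open>min\<close> cover both ends of an L-shaped path.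
\<close>

lemma root_node_eq:
  assumes "k \<in> {1..n}"
  shows "root (node n k) =
    (if B + 2 * k \<le> A then (A - k, k)
     else if B + 2 * (n + 1 - k) \<le> A then (A - (n + 1 - k), n + 1 - k)
     else if 2 * k < A + B then (max k (A - k), min k (A - k))
     else (min k (B + (n + 1 - k)), min (k - B) (n + 1 - k)))"
proof (cases "2 * k \<le> n + 1")
  case True
  then have "node n k = (k, k)" by (auto simp: node_def)
  then show ?thesis using True assms BA An by (auto simp: max_def min_def)
next
  case False
  define m where "m = n + 1 - k"
  have m: "node n k = (k, m)" "m < k" "A \<le> k + m"
    using False assms An by (auto simp: node_def m_def)
  consider "k + m = A" | "A < k + m" "B + m \<le> k" | "A < k + m" "k < B + m" using m by linarith
  then have "root (k, m) = (if B + 2 * k \<le> A then (A - k, k)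
     else if B + 2 * m \<le> A then (A - m, m)
     else if 2 * k < A + B then (max k (A - k), min k (A - k))
     else (min k (B + m), min (k - B) m))"
  proof cases
    case 1
    then have "root (k, m) = (k, m)" by auto
    then show ?thesis using 1 m(2) BA by (auto simp: max_def min_def)
  next
    case 2
    then show ?thesis using m(2) BA by (auto simp: max_def min_def)
  next
    case 3
    then show ?thesis using m(2) BA by (auto simp: max_def min_def)
  qed
  then show ?thesis unfolding m(1) m_def .
qed

lemma root_node_cases:
  assumes "k \<in> {1..n}"
  obtains (first) "B + 2 * k \<le> A" "root (node n k) = (A - k, k)"
    | (last) m where "k + m = n + 1" "m < k" "B + 2 * m \<le> A" "root (node n k) = (A - m, m)"
    | (upper) m where "k + m = n + 1" "A < B + 2 * k" "A < B + 2 * m" "2 * k < A + B"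
      "root (node n k) = (max k (A - k), min k (A - k))"
    | (lower) m where "k + m = n + 1" "A < B + 2 * k" "A < B + 2 * m" "A + B \<le> 2 * k"
      "root (node n k) = (min k (B + m), min (k - B) m)"
proof -
  define m where "m = n + 1 - k"
  have m: "k + m = n + 1" using assms by (simp add: m_def)
  have eq: "root (node n k) = (if B + 2 * k \<le> A then (A - k, k)
     else if B + 2 * m \<le> A then (A - m, m)
     else if 2 * k < A + B then (max k (A - k), min k (A - k))
     else (min k (B + m), min (k - B) m))"
    unfolding m_def by (rule root_node_eq[OF assms])
  consider "B + 2 * k \<le> A" | "A < B + 2 * k" "B + 2 * m \<le> A"
    | "A < B + 2 * k" "A < B + 2 * m" "2 * k < A + B" | "A < B + 2 * k" "A < B + 2 * m" "A + B \<le> 2 * k"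
    by linarith
  then show thesis
  proof cases
    case 1 show thesis using 1 eq by (intro first) simp_all
  next
    case 2 show thesis using 2 eq m by (intro last[of m]) simp_all
  next
    case 3 show thesis using 3 eq m by (intro upper[of m]) simp_all
  next
    case 4 show thesis using 4 eq m by (intro lower[of m]) simp_all
  qed
qed

text \<open>
  Two different nodes of one part sum to \<open>n + 1\<close> (column up to the center), to \<open>A\<close> (nested
  pairing above the center) or to \<open>n + 1 + B\<close> (nested pairing below it). The inequalities say
  on which side of the column of the center the pair lies, and are not strict: if the center is
  a vertex, its three nodes form one part, and their pairwise sums are of all three kinds.
\<close>

definition same_part :: "nat \<Rightarrow> nat \<Rightarrow> bool" where
  "same_part k l \<longleftrightarrow> k = l \<or> (k + l = n + 1 \<and> (B + 2 * k \<le> A \<or> B + 2 * l \<le> A)) \<or>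
    (k + l = A \<and> A \<le> B + 2 * k \<and> A \<le> B + 2 * l) \<or>
    (k + l = n + 1 + B \<and> A + 2 * k \<le> B + 2 * (n + 1) \<and> A + 2 * l \<le> B + 2 * (n + 1))"

lemma same_root_nodes_iff:
  assumes k: "k \<in> {1..n}" and l: "l \<in> {1..n}"
  shows "root (node n k) = root (node n l) \<longleftrightarrow> same_part k l"
  using k BA An
  by (cases rule: root_node_cases; use l in \<open>cases rule: root_node_cases\<close>;
      auto simp: same_part_def max_def min_def split: if_splits)

lemma node_classes_eqI:
  assumes nonempty: "\<And>q. q \<in> Q \<Longrightarrow> q \<noteq> {}" and cover: "\<Union>Q = {1..n}"
    and same: "\<And>q k l. q \<in> Q \<Longrightarrow> k \<in> q \<Longrightarrow> l \<in> q \<Longrightarrow> same_part k l"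
    and other: "\<And>q k l. q \<in> Q \<Longrightarrow> k \<in> q \<Longrightarrow> same_part k l \<Longrightarrow> 1 \<le> l \<Longrightarrow> l \<le> n \<Longrightarrow> l \<in> q"
  shows "node_classes = Q"
  unfolding node_classes_def
proof (rule quotient_eqI)
  fix q k assume q: "q \<in> Q" "k \<in> q"
  then have "k \<in> {1..n}" using cover by blast
  then have "{(k, l) \<in> {1..n} \<times> {1..n}. root (node n k) = root (node n l)} `` {k} = {l \<in> {1..n}. same_part k l}"
    using same_root_nodes_iff by auto
  also have "\<dots> = q"
    using same[OF q] other[OF q] cover q(1) by auto
  finally show "{(k, l) \<in> {1..n} \<times> {1..n}. root (node n k) = root (node n l)} `` {k} = q" .
qed (use nonempty cover in auto)

end

lemma center_vertex: "(i, j) \<in> vertices n \<Longrightarrow> center n (i + j) (i - j)"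
  by unfold_locales (auto simp: vertices_iff)

lemma center_face: "(i, j) \<in> faces n \<Longrightarrow> center n (Suc (i + j)) (i - j)"
  by unfold_locales (auto simp: faces_def)

lemma nested_pairing_member:
  "q \<in> nested_pairing a b \<longleftrightarrow> (\<exists>k l. k \<le> l \<and> k + l = a + b \<and> a \<le> k \<and> q = {k, l})"
proof
  assume "q \<in> nested_pairing a b"
  then obtain t where "q = {a + t, b - t}" "a + 2 * t \<le> b" unfolding nested_pairing_def by blast
  then show "\<exists>k l. k \<le> l \<and> k + l = a + b \<and> a \<le> k \<and> q = {k, l}"
    by (intro exI[of _ "a + t"] exI[of _ "b - t"]) auto
next
  assume "\<exists>k l. k \<le> l \<and> k + l = a + b \<and> a \<le> k \<and> q = {k, l}"
  then obtain k l where "k \<le> l" "k + l = a + b" "a \<le> k" "q = {k, l}" by blast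
  then show "q \<in> nested_pairing a b"
    unfolding nested_pairing_def by (intro CollectI exI[of _ "k - a"]) auto
qed

lemma Union_nested_pairing: "\<Union>(nested_pairing a b) = {a..b}"
proof (intro equalityI subsetI)
  fix x assume "x \<in> \<Union>(nested_pairing a b)"
  then show "x \<in> {a..b}" by (auto simp: nested_pairing_def)
next
  fix x assume x: "x \<in> {a..b}"
  define y where "y = a + b - x"
  have "{min x y, max x y} \<in> nested_pairing a b"
    unfolding nested_pairing_member
    using x by (intro exI[of _ "min x y"] exI[of _ "max x y"]) (auto simp: y_def)
  moreover have "x \<in> {min x y, max x y}" by (auto simp: min_def max_def)
  ultimately show "x \<in> \<Union>(nested_pairing a b)" by blast
qed

text \<open>
  Here \<open>A - B = 2 * j + 1\<close> is odd, so the bounds in \<open>same_part\<close> can be halved and rounded.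
\<close>

lemma (in center) same_part_face:
  assumes "A = Suc (i + j)" "i = B + j"
  shows "same_part k l \<longleftrightarrow> k = l \<or> (k + l = n + 1 \<and> (k \<le> j \<or> l \<le> j)) \<or>
    (k + l = A \<and> j < k \<and> j < l) \<or>
    (k + l + j = n + 1 + i \<and> k + j \<le> n \<and> l + j \<le> n)"
proof -
  have "B + 2 * m \<le> A \<longleftrightarrow> m \<le> j" "A \<le> B + 2 * m \<longleftrightarrow> j < m"
    "A + 2 * m \<le> B + 2 * (n + 1) \<longleftrightarrow> m + j \<le> n" for m
    unfolding assms by arith+
  moreover have "k + l = n + 1 + B \<longleftrightarrow> k + l + j = n + 1 + i" unfolding assms by linarith
  ultimately show ?thesis unfolding same_part_def by blast
qed

lemma face_partition_eq:
  assumes "(i, j) \<in> faces n"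
  shows "face_partition n (i, j) = center.node_classes n (Suc (i + j)) (i - j)"
proof -
  interpret center n "Suc (i + j)" "i - j" using assms by (rule center_face)
  have f: "1 \<le> i" "j \<le> i" "i + j \<le> n" "i + 1 \<le> n" using assms by (auto simp: faces_def)
  note same_part = same_part_face[OF refl le_add_diff_inverse2[OF f(2), symmetric]]
  show ?thesis
  proof (rule node_classes_eqI[symmetric])
    show "q \<noteq> {}" if "q \<in> face_partition n (i, j)" for q
      using that by (auto simp: nested_pairing_def)
    have "\<Union>{{k, n + 1 - k} |k. 1 \<le> k \<and> k \<le> j} = {1..j} \<union> {n + 1 - j..n}"
    proof (intro equalityI subsetI)
      fix x assume "x \<in> {1..j} \<union> {n + 1 - j..n}"
      then consider "1 \<le> x" "x \<le> j" | "n + 1 - j \<le> x" "x \<le> n" by auto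
      then show "x \<in> \<Union>{{k, n + 1 - k} |k. 1 \<le> k \<and> k \<le> j}"
      proof cases
        case 1 then show ?thesis by blast
      next
        case 2
        then have "x \<in> {n + 1 - x, n + 1 - (n + 1 - x)}" "1 \<le> n + 1 - x" "n + 1 - x \<le> j" by auto
        then show ?thesis by blast
      qed
    qed (use f in auto)
    then have "\<Union>(face_partition n (i, j)) = ({1..j} \<union> {n + 1 - j..n}) \<union> {j + 1..i} \<union> {i + 1..n - j}"
      unfolding face_partition.simps Union_Un_distrib Union_nested_pairing by simp
    also have "\<dots> = {1..n}"
    proof (intro equalityI subsetI)
      fix x assume "x \<in> {1..n}"
      then consider "x \<le> j" | "j < x" "x \<le> i" | "i < x" "x + j \<le> n" | "n < x + j" by linarith
      then show "x \<in> ({1..j} \<union> {n + 1 - j..n}) \<union> {j + 1..i} \<union> {i + 1..n - j}"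
        by cases (use f \<open>x \<in> {1..n}\<close> in auto)
    qed (use f in auto)
    finally show "\<Union>(face_partition n (i, j)) = {1..n}" .
    fix q k l assume q: "q \<in> face_partition n (i, j)" and k: "k \<in> q"
    from q consider (column) m where "1 \<le> m" "m \<le> j" "q = {m, n + 1 - m}"
      | (above) a b where "a \<le> b" "a + b = Suc (i + j)" "j < a" "q = {a, b}"
      | (below) a b where "a \<le> b" "a + b + j = i + 1 + n" "i < a" "q = {a, b}"
      using f by (auto simp: nested_pairing_member)
    note q_cases = this
    show "same_part k l" if l: "l \<in> q"
      using q_cases
    proof cases
      case column
      then show ?thesis using k l f unfolding same_part by auto
    next
      case above
      then have "k = a \<or> k = b" "l = a \<or> l = b" using k l by auto
      then show ?thesis unfolding same_part by (elim disjE; use above f in linarith)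
    next
      case below
      then have "k = a \<or> k = b" "l = a \<or> l = b" using k l by auto
      then show ?thesis unfolding same_part by (elim disjE; use below f in linarith)
    qed
    show "l \<in> q" if kl: "same_part k l" and l: "1 \<le> l" "l \<le> n"
    proof (rule ccontr)
      assume "l \<notin> q"
      with k have ne: "k \<noteq> l" by blast
      show False using q_cases
      proof cases
        case (column m)
        define m' where "m' = n + 1 - m"
        have m': "m + m' = n + 1" "q = {m, m'}" using column f by (auto simp: m'_def)
        then have "l \<noteq> m" "l \<noteq> m'" "k = m \<or> k = m'" using \<open>l \<notin> q\<close> k by auto
        with kl ne show False unfolding same_part by (elim disjE conjE; use column(1,2) m' f l in linarith)
      next
        case (above a b)
        then have "l \<noteq> a" "l \<noteq> b" "k = a \<or> k = b" using \<open>l \<notin> q\<close> k by auto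
        with kl ne show False unfolding same_part by (elim disjE conjE; use above f l in linarith)
      next
        case (below a b)
        then have "l \<noteq> a" "l \<noteq> b" "k = a \<or> k = b" using \<open>l \<notin> q\<close> k by auto
        with kl ne show False unfolding same_part by (elim disjE conjE; use below f l in linarith)
      qed
    qed
  qed
qed

lemma (in center) same_part_vertex:
  assumes "A = i + j" "i = B + j"
  shows "same_part k l \<longleftrightarrow> k = l \<or> (k + l = n + 1 \<and> (k \<le> j \<or> l \<le> j)) \<or>
    (k + l = A \<and> j \<le> k \<and> j \<le> l) \<or>
    (k + l + j = n + 1 + i \<and> k + j \<le> n + 1 \<and> l + j \<le> n + 1)"
proof -
  have "B + 2 * m \<le> A \<longleftrightarrow> m \<le> j" "A \<le> B + 2 * m \<longleftrightarrow> j \<le> m"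
    "A + 2 * m \<le> B + 2 * (n + 1) \<longleftrightarrow> m + j \<le> n + 1" for m
    unfolding assms by arith+
  moreover have "k + l = n + 1 + B \<longleftrightarrow> k + l + j = n + 1 + i" unfolding assms by linarith
  ultimately show ?thesis unfolding same_part_def by blast
qed

lemma vertex_partition_eq:
  assumes "(i, j) \<in> vertices n"
  shows "vertex_partition n (i, j) = center.node_classes n (i + j) (i - j)"
proof -
  interpret center n "i + j" "i - j" using assms by (rule center_vertex)
  have v: "1 \<le> j" "j \<le> i" "i + j \<le> n + 1" using assms unfolding vertices_iff by blast+
  note same_part = same_part_vertex[OF refl le_add_diff_inverse2[OF v(2), symmetric]]
  show ?thesis
  proof (rule node_classes_eqI[symmetric])
    show "q \<noteq> {}" if "q \<in> vertex_partition n (i, j)" for q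
      using that by (auto simp: nested_pairing_def)
    have "\<Union>{{k, n + 1 - k} |k. 1 \<le> k \<and> k \<le> j - 1} = {1..j - 1} \<union> {n + 2 - j..n}"
    proof (intro equalityI subsetI)
      fix x assume "x \<in> {1..j - 1} \<union> {n + 2 - j..n}"
      then consider "1 \<le> x" "x \<le> j - 1" | "n + 2 - j \<le> x" "x \<le> n" by auto
      then show "x \<in> \<Union>{{k, n + 1 - k} |k. 1 \<le> k \<and> k \<le> j - 1}"
      proof cases
        case 1 then show ?thesis by blast
      next
        case 2
        then have "x \<in> {n + 1 - x, n + 1 - (n + 1 - x)}" "1 \<le> n + 1 - x" "n + 1 - x \<le> j - 1" by auto
        then show ?thesis by blast
      qed
    qed (use v in auto)
    then have "\<Union>(vertex_partition n (i, j)) = {i, j, n + 1 - j} \<union> ({1..j - 1} \<union> {n + 2 - j..n}) \<union>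
      {j + 1..i - 1} \<union> {i + 1..n - j}"
      unfolding vertex_partition.simps Union_Un_distrib Union_nested_pairing by simp
    also have "\<dots> = {1..n}"
    proof (intro equalityI subsetI)
      fix x assume "x \<in> {1..n}"
      then consider "x < j" | "x = j" | "j < x" "x < i" | "x = i" | "i < x" "x + j \<le> n"
        | "x = n + 1 - j" | "n + 1 < x + j" by linarith
      then show "x \<in> {i, j, n + 1 - j} \<union> ({1..j - 1} \<union> {n + 2 - j..n}) \<union> {j + 1..i - 1} \<union> {i + 1..n - j}"
        by cases (use v \<open>x \<in> {1..n}\<close> in auto)
    qed (use v in auto)
    finally show "\<Union>(vertex_partition n (i, j)) = {1..n}" .
    fix q k l assume q: "q \<in> vertex_partition n (i, j)" and k: "k \<in> q"
    from q consider (center) "q = {i, j, n + 1 - j}"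
      | (column) m where "1 \<le> m" "m < j" "q = {m, n + 1 - m}"
      | (above) a b where "a \<le> b" "a + b = i + j" "j < a" "q = {a, b}"
      | (below) a b where "a \<le> b" "a + b + j = i + 1 + n" "i < a" "q = {a, b}"
      using v by (auto simp: nested_pairing_member)
    note q_cases = this
    show "same_part k l" if l: "l \<in> q"
      using q_cases
    proof cases
      case center
      then show ?thesis using k l v unfolding same_part by auto
    next
      case column
      then show ?thesis using k l v unfolding same_part by auto
    next
      case above
      then have "k = a \<or> k = b" "l = a \<or> l = b" using k l by auto
      then show ?thesis unfolding same_part by (elim disjE; use above v in linarith)
    next
      case below
      then have "k = a \<or> k = b" "l = a \<or> l = b" using k l by auto
      then show ?thesis unfolding same_part by (elim disjE; use below v in linarith)
    qed
    show "l \<in> q" if kl: "same_part k l" and l: "1 \<le> l" "l \<le> n"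
    proof (rule ccontr)
      assume "l \<notin> q"
      with k have ne: "k \<noteq> l" by blast
      show False using q_cases
      proof cases
        case center
        define m' where "m' = n + 1 - j"
        have m': "j + m' = n + 1" "q = {i, j, m'}" using center v by (auto simp: m'_def)
        then have "l \<noteq> i" "l \<noteq> j" "l \<noteq> m'" "k = i \<or> k = j \<or> k = m'" using \<open>l \<notin> q\<close> k by auto
        with kl ne show False unfolding same_part by (elim disjE conjE; use m' v l in linarith)
      next
        case (column m)
        define m' where "m' = n + 1 - m"
        have m': "m + m' = n + 1" "q = {m, m'}" using column v by (auto simp: m'_def)
        then have "l \<noteq> m" "l \<noteq> m'" "k = m \<or> k = m'" using \<open>l \<notin> q\<close> k by auto
        with kl ne show False unfolding same_part by (elim disjE conjE; use column(1,2) m' v l in linarith)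
      next
        case (above a b)
        then have "l \<noteq> a" "l \<noteq> b" "k = a \<or> k = b" using \<open>l \<notin> q\<close> k by auto
        with kl ne show False unfolding same_part by (elim disjE conjE; use above v l in linarith)
      next
        case (below a b)
        then have "l \<noteq> a" "l \<noteq> b" "k = a \<or> k = b" using \<open>l \<notin> q\<close> k by auto
        with kl ne show False unfolding same_part by (elim disjE conjE; use below v l in linarith)
      qed
    qed
  qed
qed


section \<open>Edges of the groves around an edge\<close>

context center
begin

lemma vertical_in_forest:
  assumes "(r, c) \<in> vertices n" "(r + 1, c) \<in> vertices n"
  shows "{(r, c), (r + 1, c)} \<in> forest \<longleftrightarrow> r + 1 + c \<le> A \<or> B + c \<le> r"
proof
  assume "{(r, c), (r + 1, c)} \<in> forest"
  then obtain x where x: "x \<in> vertices n" "parent x \<noteq> x" "{(r, c), (r + 1, c)} = {x, parent x}"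
    unfolding forest_def by blast
  from x(1,2) show "r + 1 + c \<le> A \<or> B + c \<le> r"
    by (cases rule: parent_cases) (use x(3) in \<open>auto simp: doubleton_eq_iff\<close>)
next
  assume *: "r + 1 + c \<le> A \<or> B + c \<le> r"
  show "{(r, c), (r + 1, c)} \<in> forest"
  proof (cases "r + 1 + c \<le> A")
    case True
    then show ?thesis using forest_edgeI[OF assms(1), of "(r + 1, c)"] by simp
  next
    case False
    then show ?thesis using * forest_edgeI[OF assms(2), of "(r, c)"] by (simp add: insert_commute)
  qed
qed

lemma horizontal_in_forest:
  assumes "(r, c) \<in> vertices n" "(r, c + 1) \<in> vertices n"
  shows "{(r, c), (r, c + 1)} \<in> forest \<longleftrightarrow> A \<le> r + c \<and> r \<le> B + c"
proof
  assume "{(r, c), (r, c + 1)} \<in> forest"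
  then obtain x where x: "x \<in> vertices n" "parent x \<noteq> x" "{(r, c), (r, c + 1)} = {x, parent x}"
    unfolding forest_def by blast
  from x(1,2) show "A \<le> r + c \<and> r \<le> B + c"
    by (cases rule: parent_cases) (use x(3) in \<open>auto simp: doubleton_eq_iff\<close>)
next
  assume "A \<le> r + c \<and> r \<le> B + c"
  then show "{(r, c), (r, c + 1)} \<in> forest"
    using forest_edgeI[OF assms(2), of "(r, c)"] by (simp add: insert_commute)
qed

end

text \<open>
  The exponents of each weight on the two sides agree.
\<close>

lemma prod_four_subsets:
  fixes a :: "'a \<Rightarrow> 'b :: comm_semiring_1"
  assumes "finite E" "e \<in> E" "V1 \<subseteq> E" "V2 \<subseteq> E" "F1 \<subseteq> E" "F2 \<subseteq> E"
    and here: "of_bool (e \<in> V1) + of_bool (e \<in> V2) = Suc (of_bool (e \<in> F1) + of_bool (e \<in> F2))"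
    and elsewhere: "\<And>d. d \<in> E \<Longrightarrow> d \<noteq> e \<Longrightarrow>
      of_bool (d \<in> V1) + of_bool (d \<in> V2) = (of_bool (d \<in> F1) + of_bool (d \<in> F2) :: nat)"
  shows "prod a V1 * prod a V2 = a e * (prod a F1 * prod a F2)"
proof -
  have as_power: "prod a S = (\<Prod>d\<in>E. a d ^ of_bool (d \<in> S))" if "S \<subseteq> E" for S
  proof -
    have "prod a S = (\<Prod>d\<in>E. if d \<in> S then a d else 1)"
      using prod.inter_restrict[OF assms(1), of a S] that by (simp add: Int_absorb1)
    then show ?thesis by (simp add: of_bool_def if_distrib cong: if_cong)
  qed
  have "prod a V1 * prod a V2 = (\<Prod>d\<in>E. a d ^ (of_bool (d \<in> V1) + of_bool (d \<in> V2)))"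
    using assms by (simp add: as_power prod.distrib power_add)
  also have "\<dots> = (\<Prod>d\<in>E. (if d = e then a d else 1) * a d ^ (of_bool (d \<in> F1) + of_bool (d \<in> F2)))"
  proof (rule prod.cong[OF refl])
    fix d assume d: "d \<in> E"
    show "a d ^ (of_bool (d \<in> V1) + of_bool (d \<in> V2)) =
        (if d = e then a d else 1) * a d ^ (of_bool (d \<in> F1) + of_bool (d \<in> F2))"
    proof (cases "d = e")
      case True
      then show ?thesis using here by simp
    next
      case False
      then show ?thesis using elsewhere[OF d] by simp
    qed
  qed
  also have "\<dots> = a e * (prod a F1 * prod a F2)"
    using assms by (simp add: as_power prod.distrib power_add)
  finally show ?thesis .
qed

abbreviation vertex_grove :: "nat \<Rightarrow> vertex \<Rightarrow> vertex set set" where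
  "vertex_grove n v \<equiv> center.forest n (fst v + snd v) (fst v - snd v)"

abbreviation face_grove :: "nat \<Rightarrow> nat \<times> nat \<Rightarrow> vertex set set" where
  "face_grove n f \<equiv> center.forest n (Suc (fst f + snd f)) (fst f - snd f)"

lemma Z_vertex: "v \<in> vertices n \<Longrightarrow> Z n a (vertex_partition n v) = prod a (vertex_grove n v)"
proof -
  assume v: "v \<in> vertices n"
  obtain i j where ij: "v = (i, j)" by (cases v)
  show ?thesis
    using center.Z_eq_prod[OF center_vertex] vertex_partition_eq v unfolding ij by simp
qed

lemma Z_face: "f \<in> faces n \<Longrightarrow> Z n a (face_partition n f) = prod a (face_grove n f)"
proof -
  assume f: "f \<in> faces n"
  obtain i j where ij: "f = (i, j)" by (cases f)
  show ?thesis
    using center.Z_eq_prod[OF center_face] face_partition_eq f unfolding ij by simp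
qed

lemma vertex_grove_subset: "v \<in> vertices n \<Longrightarrow> vertex_grove n v \<subseteq> edges n"
  by (cases v) (simp add: center.forest_subset[OF center_vertex])

lemma face_grove_subset: "f \<in> faces n \<Longrightarrow> face_grove n f \<subseteq> edges n"
  by (cases f) (simp add: center.forest_subset[OF center_face])

lemma vertical_in_vertex_grove:
  assumes "(i, j) \<in> vertices n" "(r, c) \<in> vertices n" "(r + 1, c) \<in> vertices n"
  shows "{(r, c), (r + 1, c)} \<in> vertex_grove n (i, j) \<longleftrightarrow> r + 1 + c \<le> i + j \<or> i + c \<le> r + j"
  using center.vertical_in_forest[OF center_vertex[OF assms(1)] assms(2,3)] assms(1)
  by (auto simp: vertices_iff)

lemma horizontal_in_vertex_grove:
  assumes "(i, j) \<in> vertices n" "(r, c) \<in> vertices n" "(r, c + 1) \<in> vertices n"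
  shows "{(r, c), (r, c + 1)} \<in> vertex_grove n (i, j) \<longleftrightarrow> i + j \<le> r + c \<and> r + j \<le> i + c"
  using center.horizontal_in_forest[OF center_vertex[OF assms(1)] assms(2,3)] assms(1)
  by (auto simp: vertices_iff)

lemma vertical_in_face_grove:
  assumes "(i, j) \<in> faces n" "(r, c) \<in> vertices n" "(r + 1, c) \<in> vertices n"
  shows "{(r, c), (r + 1, c)} \<in> face_grove n (i, j) \<longleftrightarrow> r + c \<le> i + j \<or> i + c \<le> r + j"
  using center.vertical_in_forest[OF center_face[OF assms(1)] assms(2,3)] assms(1)
  by (auto simp: faces_def)

lemma horizontal_in_face_grove:
  assumes "(i, j) \<in> faces n" "(r, c) \<in> vertices n" "(r, c + 1) \<in> vertices n"
  shows "{(r, c), (r, c + 1)} \<in> face_grove n (i, j) \<longleftrightarrow> i + j < r + c \<and> r + j \<le> i + c"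
  using center.horizontal_in_forest[OF center_face[OF assms(1)] assms(2,3)] assms(1)
  by (auto simp: faces_def)

text \<open>
  The bounds in the four preceding lemmas switch for \<open>d\<close> when the center passes the antidiagonal or
  the diagonal through the midpoint of \<open>d\<close>. Both lie within the unit square of the four centers only if
  \<open>d\<close> and \<open>e\<close> have the same midpoint; for edges of different directions, parity rules this out.
\<close>

lemma vertical_balance:
  assumes "(i, j) \<in> vertices n" "(i + 1, j) \<in> vertices n"
  defines "e \<equiv> {(i, j), (i + 1, j)}"
  shows "prod a (vertex_grove n (i, j)) * prod a (vertex_grove n (i + 1, j)) =
    (a e :: real) * (prod a (face_grove n (i, j - 1)) * prod a (face_grove n (i, j)))"
proof -
  have v: "1 \<le> j" "j \<le> i" "i + 1 + j \<le> n + 1" using assms(1,2) unfolding vertices_iff by blast+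
  obtain j' where j': "j = Suc j'" using v(1) by (cases j) auto
  have f: "(i, j') \<in> faces n" "(i, j) \<in> faces n" using v by (auto simp: faces_def j')
  note V = vertical_in_vertex_grove[OF assms(1)] vertical_in_vertex_grove[OF assms(2)]
    vertical_in_face_grove[OF f(1)] vertical_in_face_grove[OF f(2)]
  note H = horizontal_in_vertex_grove[OF assms(1)] horizontal_in_vertex_grove[OF assms(2)]
    horizontal_in_face_grove[OF f(1)] horizontal_in_face_grove[OF f(2)]
  have "prod a (vertex_grove n (i, j)) * prod a (vertex_grove n (i + 1, j)) =
    a e * (prod a (face_grove n (i, j')) * prod a (face_grove n (i, j)))"
  proof (rule prod_four_subsets[OF finite_edges])
    show "e \<in> edges n" using assms(1,2) unfolding e_def edges_def by blast
    show "of_bool (e \<in> vertex_grove n (i, j)) + of_bool (e \<in> vertex_grove n (i + 1, j)) =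
      Suc (of_bool (e \<in> face_grove n (i, j')) + of_bool (e \<in> face_grove n (i, j)))"
      unfolding e_def V[OF assms(1,2)] by (simp add: j')
    fix d assume d: "d \<in> edges n" "d \<noteq> e"
    from d(1) show "of_bool (d \<in> vertex_grove n (i, j)) + of_bool (d \<in> vertex_grove n (i + 1, j)) =
      (of_bool (d \<in> face_grove n (i, j')) + of_bool (d \<in> face_grove n (i, j)) :: nat)"
    proof (cases rule: edges_cases)
      case (vertical r c)
      then have "r \<noteq> i \<or> c \<noteq> j" using d(2) e_def by blast
      then show ?thesis unfolding vertical(1) V[OF vertical(2,3)] unfolding j' of_bool_def by auto
    next
      case (horizontal r c)
      \<comment> \<open>Both bounds of \<open>d\<close> could switch only if \<open>2 * r = 2 * i + 1\<close>.\<close>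
      show ?thesis unfolding horizontal(1) H[OF horizontal(2,3)] unfolding j' of_bool_def by (auto; presburger)
    qed
  qed (use assms f in \<open>simp_all add: vertex_grove_subset face_grove_subset del: fst_conv snd_conv\<close>)
  then show ?thesis by (simp add: j')
qed

lemma horizontal_balance:
  assumes "(i, j) \<in> vertices n" "(i, j + 1) \<in> vertices n"
  defines "e \<equiv> {(i, j), (i, j + 1)}"
  shows "prod a (vertex_grove n (i, j)) * prod a (vertex_grove n (i, j + 1)) =
    (a e :: real) * (prod a (face_grove n (i - 1, j)) * prod a (face_grove n (i, j)))"
proof -
  have v: "1 \<le> j" "j + 1 \<le> i" "i + (j + 1) \<le> n + 1" using assms(1,2) unfolding vertices_iff by blast+
  obtain i' where i': "i = Suc i'" using v(2) by (cases i) auto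
  have f: "(i', j) \<in> faces n" "(i, j) \<in> faces n" using v by (auto simp: faces_def i')
  note V = vertical_in_vertex_grove[OF assms(1)] vertical_in_vertex_grove[OF assms(2)]
    vertical_in_face_grove[OF f(1)] vertical_in_face_grove[OF f(2)]
  note H = horizontal_in_vertex_grove[OF assms(1)] horizontal_in_vertex_grove[OF assms(2)]
    horizontal_in_face_grove[OF f(1)] horizontal_in_face_grove[OF f(2)]
  have "prod a (vertex_grove n (i, j)) * prod a (vertex_grove n (i, j + 1)) =
    a e * (prod a (face_grove n (i', j)) * prod a (face_grove n (i, j)))"
  proof (rule prod_four_subsets[OF finite_edges])
    show "e \<in> edges n" using assms(1,2) unfolding e_def edges_def by blast
    show "of_bool (e \<in> vertex_grove n (i, j)) + of_bool (e \<in> vertex_grove n (i, j + 1)) =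
      Suc (of_bool (e \<in> face_grove n (i', j)) + of_bool (e \<in> face_grove n (i, j)))"
      unfolding e_def H[OF assms(1,2)] by (simp add: i')
    fix d assume d: "d \<in> edges n" "d \<noteq> e"
    from d(1) show "of_bool (d \<in> vertex_grove n (i, j)) + of_bool (d \<in> vertex_grove n (i, j + 1)) =
      (of_bool (d \<in> face_grove n (i', j)) + of_bool (d \<in> face_grove n (i, j)) :: nat)"
    proof (cases rule: edges_cases)
      case (vertical r c)
      \<comment> \<open>Both bounds of \<open>d\<close> could switch only if \<open>2 * i = 2 * r + 1\<close>.\<close>
      show ?thesis unfolding vertical(1) V[OF vertical(2,3)] unfolding i' of_bool_def by (auto; presburger)
    next
      case (horizontal r c)
      then have "r \<noteq> i \<or> c \<noteq> j" using d(2) e_def by blast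
      then show ?thesis unfolding horizontal(1) H[OF horizontal(2,3)] unfolding i' of_bool_def by auto
    qed
  qed (use assms f in \<open>simp_all add: vertex_grove_subset face_grove_subset del: fst_conv snd_conv\<close>)
  then show ?thesis by (simp add: i')
qed

lemma conductance_product:
  fixes a :: "vertex set \<Rightarrow> real"
  assumes "e \<in> edges n" "e = {v1, v2}" "adjacent_faces n e = {f1, f2}" "f1 \<noteq> f2"
  shows "prod a (vertex_grove n v1) * prod a (vertex_grove n v2) =
    a e * (prod a (face_grove n f1) * prod a (face_grove n f2))"
  using assms(1)
proof (cases rule: edges_cases)
  case (vertical i j)
  have "{f1, f2} = {(i, j - 1), (i, j)}"
    using assms(3) adjacent_faces_vertical[OF vertical(2,3)] vertical(1) by simp
  moreover have "{v1, v2} = {(i, j), (i + 1, j)}" using assms(2) vertical(1) by simp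
  ultimately show ?thesis
    using vertical_balance[OF vertical(2,3), of a] vertical(1)
    unfolding doubleton_eq_iff by (elim disjE conjE; simp add: mult_ac)
next
  case (horizontal i j)
  have "{f1, f2} = {(i - 1, j), (i, j)}"
    using assms(3) adjacent_faces_horizontal[OF horizontal(2,3)] horizontal(1) by simp
  moreover have "{v1, v2} = {(i, j), (i, j + 1)}" using assms(2) horizontal(1) by simp
  ultimately show ?thesis
    using horizontal_balance[OF horizontal(2,3), of a] horizontal(1)
    unfolding doubleton_eq_iff by (elim disjE conjE; simp add: mult_ac)
qed

theorem lemma7p1:
  fixes n :: nat and a :: "vertex set \<Rightarrow> real"
    and e :: "vertex set" and v1 v2 :: vertex and f1 f2 :: "nat \<times> nat"
  assumes "n \<ge> 2"
    and "\<And>e'. e' \<in> edges n \<Longrightarrow> a e' > 0"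
    and "e \<in> edges n"
    and "e = {v1, v2}"
    and "adjacent_faces n e = {f1, f2}" and "f1 \<noteq> f2"
  shows "a e = (Z n a (vertex_partition n v1) * Z n a (vertex_partition n v2)) /
               (Z n a (face_partition n f1) * Z n a (face_partition n f2))"
proof -
  have v: "v1 \<in> vertices n" "v2 \<in> vertices n" using edges_subset assms(3,4) by blast+
  have f: "f1 \<in> faces n" "f2 \<in> faces n" using assms(5) unfolding adjacent_faces_def by blast+
  have "prod a (face_grove n f) > 0" if "f \<in> faces n" for f
    using face_grove_subset[OF that] assms(2) by (intro prod_pos) blast
  then have "prod a (face_grove n f1) * prod a (face_grove n f2) \<noteq> 0"
    using f by (metis mult_pos_pos less_irrefl)
  then show ?thesis
    unfolding Z_vertex[OF v(1)] Z_vertex[OF v(2)] Z_face[OF f(1)] Z_face[OF f(2)]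
      conductance_product[OF assms(3-6)] by simp
qed

end
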